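(* Let $X(t)$ be a self-dual Hunt process on a state space $D$ with a finite reference measure $m$, and consider the Fleming--Viot system of two particles evolving according to $X(t)$. Suppose that for every $t>0$ and every starting point $x\in D$ the one-dimensional distribution $\mathbb P^x(X(t)\in\cdot)$ (as a measure on $D$) is absolutely continuous with respect to $m$. Then the Fleming--Viot system of two particles never becomes extinct, regardless of the initial configuration: $\bar{\mathbb P}^{x,y}(\tau_\infty=\infty)=1$ for every $(x,y)\in D\times D$.
   Context: Hunt process: $X(t)$ is a Hunt process with state space $D$, cemetery point $\partial$ and lifetime $\zeta\in(0,\infty]$ (possibly finite), with law $\mathbb P^x$ when $X(0)=x$; $X(t)=\partial$ for $t\ge\zeta$. Its transition operators are $P_tf(x)=\mathbb E^x f(X(t))$, with the convention $f(\partial)=0$ for functions $f$ on $D$. Self-dual with reference measure $m$: $m$ is a measure on $D$ such that the operators $P_t$ are self-adjoint on $L^2(D,m)$. Fleming--Viot system of two particles $(\bar X(t),\bar Y(t))$ started at $(x,y)\in D\times D$ (law $\bar{\mathbb P}^{x,y}$): set $\tau_0=0$. Let $X_1,Y_1$ be independent copies of $X$ started at $x$ and $y$, with lifetimes $\zeta^{X_1},\zeta^{Y_1}$. Recursively, for $n\ge 1$, let $\sigma_n=\min\{\zeta^{X_n},\zeta^{Y_n}\}$, $\tau_n=\tau_{n-1}+\sigma_n$, and $\bar X(\tau_{n-1}+t)=X_n(t)$, $\bar Y(\tau_{n-1}+t)=Y_n(t)$ for $t\in[0,\sigma_n)$. If $\sigma_n<\infty$, let $Z_n=X_n(\zeta^{Y_n})$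 when $\zeta^{Y_n}<\zeta^{X_n}$ and $Z_n=Y_n(\zeta^{X_n})$ when $\zeta^{X_n}<\zeta^{Y_n}$ (the position of the surviving particle); given the past, $X_{n+1},Y_{n+1}$ are then independent copies of $X$ both started at $Z_n$. If $\sigma_n=\infty$ the construction ends and $\tau_k=\infty$ for all $k\ge n$. If $\zeta^{X_n}=\zeta^{Y_n}<\infty$, then $Z_n=\partial$, the construction stops, and $\tau_k=\tau_n$ for $k\ge n$. The $\tau_n$, $n\ge1$, are the branching times and $\tau_\infty=\lim_{n\to\infty}\tau_n\in(0,\infty]$. Extinction occurs (at time $\tau_\infty$) if $\tau_\infty<\infty$. *)

theory Defs
  imports "HOL-Probability.Probability"
begin

section \<open>State space and path space\<close>

text \<open>
  The state space \<open>D\<close> is the whole type \<open>'a\<close>, the cemetery is \<open>None\<close>, and a point \<open>x\<close> of \<open>D\<close> is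
  \<open>Some x\<close>. If \<open>D\<close> is compact, the one-point compactification adjoins \<open>None\<close> as an isolated point,
  which is the usual convention. Times range over \<open>[0, \<infinity>] = ennreal\<close>, and \<open>X(\<infinity>)\<close> is the cemetery.
\<close>

definition cem_topology :: "'a::topological_space option topology" where
  "cem_topology = Alexandroff_compactification euclidean"

definition cem_borel :: "'a::topological_space option measure" where
  "cem_borel = sigma UNIV {U. openin cem_topology U}"

definition lifetime :: "(ennreal \<Rightarrow> 'a option) \<Rightarrow> ennreal" where
  "lifetime w = Inf {t. w t = None}"

definition cadlag_paths :: "(ennreal \<Rightarrow> 'a::topological_space option) set" where
  "cadlag_paths = {w.
     w \<infinity> = None \<and>
     (\<forall>t\<ge>lifetime w. w t = None) \<and>
     (\<forall>t<\<infinity>. limitin cem_topology w (w t) (at_right t)) \<and>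
     (\<forall>t. 0 < t \<and> t < \<infinity> \<longrightarrow> (\<exists>l. limitin cem_topology w l (at_left t)))}"

definition path_space :: "(ennreal \<Rightarrow> 'a::topological_space option) measure" where
  "path_space = restrict_space (\<Pi>\<^sub>M t\<in>UNIV. cem_borel) cadlag_paths"

section \<open>Hunt processes\<close>

text \<open>
  \<open>M\<close> carries the underlying measurable space \<open>(\<Omega>, \<M>)\<close>; its measure plays no role. \<open>P z\<close> is the law
  of the process started at \<open>z\<close>, and \<open>F\<close> is an admissible right-continuous filtration (\<open>F \<infinity>\<close> is any
  sub-\<open>\<sigma>\<close>-algebra containing all \<open>F t\<close>). For \<open>T = \<infinity>\<close> the strong Markov property is trivial,
  since \<open>X(\<infinity>)\<close> is the cemetery, from which the process never leaves.
\<close>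

locale hunt_process = filtration "space M" F
  for M :: "'w measure"
    and F :: "ennreal \<Rightarrow> 'w measure"
    and P :: "'a::{metric_space, second_countable_topology} option \<Rightarrow> 'w measure"
    and X :: "ennreal \<Rightarrow> 'w \<Rightarrow> 'a option" +
  assumes locally_compact: "locally_compact_space (euclidean :: 'a topology)"
    and prob_space_P: "\<And>z. prob_space (P z)"
    and sets_P: "\<And>z. sets (P z) = sets M"
    and sets_F: "\<And>t. sets (F t) \<subseteq> sets M"
    and right_continuous_F: "\<And>t. t < \<infinity> \<Longrightarrow> sets (F t) = (\<Inter>s\<in>{t<..}. sets (F s))"
    and adapted: "\<And>t. X t \<in> F t \<rightarrow>\<^sub>M cem_borel"
    and kernel_measurable: "\<And>t B. B \<in> sets cem_borel \<Longrightarrow>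
      (\<lambda>z. measure (P z) {\<omega> \<in> space M. X t \<omega> \<in> B}) \<in> borel_measurable cem_borel"
    and normal: "\<And>z. AE \<omega> in P z. X 0 \<omega> = z"
    and cadlag: "\<And>\<omega>. \<omega> \<in> space M \<Longrightarrow> (\<lambda>t. X t \<omega>) \<in> cadlag_paths"
    and strong_markov: "\<And>z T s B. stopping_time F T \<Longrightarrow> s < \<infinity> \<Longrightarrow> B \<in> sets cem_borel \<Longrightarrow>
      AE \<omega> in P z.
        real_cond_exp (P z) (pre_sigma T) (indicator {\<omega> \<in> space M. X (T \<omega> + s) \<omega> \<in> B}) \<omega>
        = measure (P (X (T \<omega>) \<omega>)) {\<omega>' \<in> space M. X s \<omega>' \<in> B}"
    and quasi_left_continuous: "\<And>z T. (\<And>n::nat. stopping_time F (T n)) \<Longrightarrow>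
      (\<And>\<omega>. \<omega> \<in> space M \<Longrightarrow> incseq (\<lambda>n. T n \<omega>)) \<Longrightarrow>
      AE \<omega> in P z. (SUP n. T n \<omega>) < \<infinity> \<longrightarrow>
        limitin cem_topology (\<lambda>n. X (T n \<omega>) \<omega>) (X (SUP n. T n \<omega>) \<omega>) sequentially"

definition path_law ::
    "('a::topological_space option \<Rightarrow> 'w measure) \<Rightarrow> (ennreal \<Rightarrow> 'w \<Rightarrow> 'a option) \<Rightarrow>
     'a option \<Rightarrow> (ennreal \<Rightarrow> 'a option) measure" where
  "path_law P X z = distr (P z) path_space (\<lambda>\<omega> t. X t \<omega>)"

text \<open>The law of \<open>X(t)\<close> as a sub-probability measure on \<open>D\<close>; mass at the cemetery is discarded.\<close>

definition one_dim_law ::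
    "('a::topological_space option \<Rightarrow> 'w measure) \<Rightarrow> (ennreal \<Rightarrow> 'w \<Rightarrow> 'a option) \<Rightarrow>
     ennreal \<Rightarrow> 'a \<Rightarrow> 'a measure" where
  "one_dim_law P X t x =
     distr (restrict_space (P (Some x)) {\<omega>. X t \<omega> \<noteq> None}) borel (\<lambda>\<omega>. the (X t \<omega>))"

section \<open>Self-duality\<close>

definition extend0 :: "('a \<Rightarrow> real) \<Rightarrow> 'a option \<Rightarrow> real" where
  "extend0 f z = (case z of None \<Rightarrow> 0 | Some x \<Rightarrow> f x)"

definition transition_op ::
    "('a option \<Rightarrow> 'w measure) \<Rightarrow> (ennreal \<Rightarrow> 'w \<Rightarrow> 'a option) \<Rightarrow>
     ennreal \<Rightarrow> ('a \<Rightarrow> real) \<Rightarrow> 'a \<Rightarrow> real" where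
  "transition_op P X t f x = (\<integral>\<omega>. extend0 f (X t \<omega>) \<partial>P (Some x))"

definition L2 :: "'a measure \<Rightarrow> ('a \<Rightarrow> real) set" where
  "L2 m = {f \<in> borel_measurable m. integrable m (\<lambda>x. (f x)\<^sup>2)}"

text \<open>
  The operators \<open>P\<^sub>t\<close> act on Borel representatives. The integrability clause says that \<open>P\<^sub>t f\<close> is
  genuinely defined almost everywhere. The symmetry with \<open>g\<close> arbitrary forces \<open>P\<^sub>t\<close> to respect
  almost everywhere equality, and an everywhere defined symmetric operator is bounded.
\<close>

definition self_dual ::
    "('a::topological_space option \<Rightarrow> 'w measure) \<Rightarrow> (ennreal \<Rightarrow> 'w \<Rightarrow> 'a option) \<Rightarrow>
     'a measure \<Rightarrow> bool" where
  "self_dual P X m \<longleftrightarrow> sets m = sets borel \<and>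
     (\<forall>t<\<infinity>. \<forall>f\<in>L2 m.
        (AE x in m. integrable (P (Some x)) (\<lambda>\<omega>. extend0 f (X t \<omega>))) \<and>
        transition_op P X t f \<in> L2 m \<and>
        (\<forall>g\<in>L2 m. (\<integral>x. transition_op P X t f x * g x \<partial>m) =
                   (\<integral>x. f x * transition_op P X t g x \<partial>m)))"

section \<open>Fleming--Viot systems of two particles\<close>

text \<open>
  A realisation of the system is described by sequences of paths \<open>u n\<close>, \<open>v n\<close>. The numbering
  starts at 0: \<open>u n\<close>, \<open>v n\<close> are the copies \<open>X\<^sub>n\<^sub>+\<^sub>1\<close>, \<open>Y\<^sub>n\<^sub>+\<^sub>1\<close> used between \<open>\<tau>\<^sub>n\<close> and \<open>\<tau>\<^sub>n\<^sub>+\<^sub>1\<close>.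
\<close>

definition stage_length :: "(ennreal \<Rightarrow> 'a option) \<Rightarrow> (ennreal \<Rightarrow> 'a option) \<Rightarrow> ennreal" where
  "stage_length u v = min (lifetime u) (lifetime v)"

text \<open>The value is \<open>None\<close> exactly when both lifetimes agree (finite or not); then the
  construction stops.\<close>

definition survivor :: "(ennreal \<Rightarrow> 'a option) \<Rightarrow> (ennreal \<Rightarrow> 'a option) \<Rightarrow> 'a option" where
  "survivor u v =
     (if lifetime v < lifetime u then u (lifetime v)
      else if lifetime u < lifetime v then v (lifetime u)
      else None)"

primrec stage_occurs ::
    "(nat \<Rightarrow> ennreal \<Rightarrow> 'a option) \<Rightarrow> (nat \<Rightarrow> ennreal \<Rightarrow> 'a option) \<Rightarrow> nat \<Rightarrow> bool" where
  "stage_occurs u v 0 = True"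
| "stage_occurs u v (Suc n) = (stage_occurs u v n \<and> survivor (u n) (v n) \<noteq> None)"

text \<open>Once the construction has stopped, \<open>\<tau>\<close> stays constant; this constant is \<open>\<infinity>\<close> if it stopped
  because some stage had infinite length.\<close>

primrec branching_time ::
    "(nat \<Rightarrow> ennreal \<Rightarrow> 'a option) \<Rightarrow> (nat \<Rightarrow> ennreal \<Rightarrow> 'a option) \<Rightarrow> nat \<Rightarrow> ennreal" where
  "branching_time u v 0 = 0"
| "branching_time u v (Suc n) =
     (if stage_occurs u v n then branching_time u v n + stage_length (u n) (v n)
      else branching_time u v n)"

text \<open>
  \<open>Q z\<close> is the path law of a single particle started at \<open>z\<close>, and \<open>S\<close> is the probability space on
  which the system started at \<open>(x, y)\<close> is realised. The paths \<open>U n \<omega>\<close>, \<open>V n \<omega>\<close> are unconstrained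
  where stage \<open>n\<close> does not occur.
\<close>

locale fleming_viot_system = prob_space S
  for S :: "'s measure"
    and Q :: "'a::topological_space option \<Rightarrow> (ennreal \<Rightarrow> 'a option) measure"
    and U V :: "nat \<Rightarrow> 's \<Rightarrow> ennreal \<Rightarrow> 'a option"
    and Xbar Ybar :: "ennreal \<Rightarrow> 's \<Rightarrow> 'a option"
    and \<tau> :: "nat \<Rightarrow> 's \<Rightarrow> ennreal"
    and x y :: 'a +
  assumes U_measurable: "\<And>n. U n \<in> S \<rightarrow>\<^sub>M path_space"
    and V_measurable: "\<And>n. V n \<in> S \<rightarrow>\<^sub>M path_space"
    and initial_law:
      "distr S (path_space \<Otimes>\<^sub>M path_space) (\<lambda>\<omega>. (U 0 \<omega>, V 0 \<omega>)) = Q (Some x) \<Otimes>\<^sub>M Q (Some y)"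
    and restart_law: "\<And>n C. C \<in> sets (path_space \<Otimes>\<^sub>M path_space) \<Longrightarrow>
      AE \<omega> in S. stage_occurs (\<lambda>k. U k \<omega>) (\<lambda>k. V k \<omega>) (Suc n) \<longrightarrow>
        real_cond_exp S
          (vimage_algebra (space S) (\<lambda>\<omega>. \<lambda>j\<in>{..n}. (U j \<omega>, V j \<omega>))
             (\<Pi>\<^sub>M j\<in>{..n}. path_space \<Otimes>\<^sub>M path_space))
          (indicator {\<omega> \<in> space S. (U (Suc n) \<omega>, V (Suc n) \<omega>) \<in> C}) \<omega>
        = measure (Q (survivor (U n \<omega>) (V n \<omega>)) \<Otimes>\<^sub>M Q (survivor (U n \<omega>) (V n \<omega>))) C"
    and tau_eq: "\<And>n \<omega>. \<omega> \<in> space S \<Longrightarrow> \<tau> n \<omega> = branching_time (\<lambda>k. U k \<omega>) (\<lambda>k. V k \<omega>) n"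
    and particles_eq: "\<And>n \<omega> t. \<omega> \<in> space S \<Longrightarrow>
      stage_occurs (\<lambda>k. U k \<omega>) (\<lambda>k. V k \<omega>) n \<Longrightarrow> t < stage_length (U n \<omega>) (V n \<omega>) \<Longrightarrow>
        Xbar (\<tau> n \<omega> + t) \<omega> = U n \<omega> t \<and> Ybar (\<tau> n \<omega> + t) \<omega> = V n \<omega> t"

end

theory Submission
  imports Defs
begin

text \<open>
  The one-stage map \<open>z \<mapsto> Z\<close> of a system started at \<open>(z, z)\<close> does not increase \<open>m\<close>: formally, with
  \<open>A\<close> the generator, the law of \<open>Z\<close> integrates to
  \<open>- 2 \<integral> \<langle>A P\<^sub>t 1, P\<^sub>t f\<rangle> dt = - \<integral> \<partial>\<^sub>t \<langle>1, P\<^sub>2\<^sub>t f\<rangle> dt \<le> \<langle>1, f\<rangle>\<close>.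
  Hence \<open>\<phi>(z) = E\<^sup>z\<^sup>,\<^sup>z exp(- \<tau>\<^sub>\<infinity>)\<close>, which satisfies \<open>\<phi>(z) = E (exp(- \<sigma>) \<phi>(Z))\<close> with \<open>\<sigma> > 0\<close>,
  vanishes \<open>m\<close>-almost everywhere. For an arbitrary starting pair the first survivor \<open>Z\<^sub>1\<close> has a law
  absolutely continuous with respect to \<open>m\<close>. Simultaneous deaths are excluded because
  \<open>t \<mapsto> \<langle>1, P\<^sub>t 1\<rangle>\<close> is midpoint convex, so that lifetimes have no atoms.
\<close>

section \<open>Regularity of finite Borel measures\<close>

text \<open>No derivative is ever taken: the formal computation is replaced by dyadic differences
  and the identity <P_s 1, P_t f> = <1, P_{s+t} f>, for which 1 must lie in L2, so \<open>m\<close>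
  is finite. Adding P_t f over both ends of each dyadic interval makes the mixed products cancel, so
  the sum telescopes. The obstacle is then the limit: these sums must dominate the value at the
  actual death time. Right-continuity of paths settles one end, the absence of jumps at fixed times
  the other, and together they give a Fatou bound on open sets only; regularity of \<open>m\<close>
  carries it to Borel sets. Finiteness of \<open>m\<close> matters again because the integral of
  \<phi> is then finite, and equality in an integrated chain of inequalities forces equality almost
  everywhere. The discount makes stage lengths visible in this chain, as a factor below 1 at each
  positive time. Midpoint convexity holds because <1, P_{2s} 1> is the squared norm of P_s 1. It
  excludes atoms only for almost every start; the Markov property at half the time, with absolute
  continuity, extends this to every start.\<close>

lemma finite_borel_measure_closed_open_approx:
  fixes m :: "'b::metric_space measure"
  assumes fin: "finite_measure m" and sets_m: "sets m = sets borel"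
    and A: "A \<in> sets borel" and e: "0 < (e::real)"
  shows "\<exists>C G. closed C \<and> open G \<and> C \<subseteq> A \<and> A \<subseteq> G \<and> measure m (G - C) < e"
proof -
  interpret finite_measure m by fact
  note [simp] = sets_m
  have "A \<in> sigma_sets UNIV (Collect closed)"
    using A by (simp add: borel_eq_closed)
  then show ?thesis
    using e
  proof (induction arbitrary: e)
    case (Basic C)
    then have C: "closed C" by simp
    show ?case
    \<comment> \<open>\<open>infdist\<close> to the empty set is 0, so for empty \<open>C\<close>
      the neighbourhoods below would be the whole space.\<close>
    proof (cases "C = {}")
      case True
      with Basic show ?thesis by (intro exI[of _ "{}"]) auto
    next
      case False
      define G where "G n = {x. infdist x C < 1 / Suc n}" for n :: nat
      have G: "open (G n)" for n
        unfolding G_def by (intro open_Collect_less continuous_intros)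
      have CG: "C \<subseteq> G n" for n
        unfolding G_def by auto
      have dec: "decseq G"
        unfolding G_def decseq_def
        by (auto intro: less_le_trans simp: frac_le)
      have int: "(\<Inter>n. G n) = C"
      proof (intro equalityI subsetI)
        fix x assume x: "x \<in> (\<Inter>n. G n)"
        have "infdist x C \<le> 0"
        proof (rule ccontr)
          assume "\<not> infdist x C \<le> 0"
          then obtain n where "1 / Suc n < infdist x C"
            using nat_approx_posE[of "infdist x C"] by auto
          with x show False unfolding G_def by (auto dest!: spec[of _ n])
        qed
        then show "x \<in> C"
          using C False infdist_nonneg[of x C] by (simp add: in_closed_iff_infdist_zero)
      qed (use CG in auto)
      have "(\<lambda>n. measure m (G n)) \<longlonglongrightarrow> measure m (\<Inter>n. G n)"
        using G dec by (intro finite_Lim_measure_decseq) auto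
      then have "eventually (\<lambda>n. measure m (G n) < measure m C + e) sequentially"
        unfolding int using Basic(2) by (auto dest!: order_tendstoD(2)[where a = "measure m C + e"])
      then obtain n where n: "measure m (G n) < measure m C + e"
        by (auto simp: eventually_sequentially)
      have "measure m (G n - C) = measure m (G n) - measure m C"
        using C G CG by (intro finite_measure_Diff) auto
      with n C G CG show ?thesis by (intro exI[of _ C] exI[of _ "G n"]) auto
    qed
  next
    case Empty
    then show ?case by (intro exI[of _ "{}"]) auto
  next
    case (Compl A)
    from Compl.IH[OF Compl.prems] obtain C G
      where *: "closed C" "open G" "C \<subseteq> A" "A \<subseteq> G" "measure m (G - C) < e" by auto
    have "(- C) - (- G) = G - C" by auto
    with * show ?case
      by (intro exI[of _ "- G"] exI[of _ "- C"]) (auto simp: open_Compl closed_Compl)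
  next
    case (Union A)
    \<comment> \<open>Half of \<open>e\<close> is spent on the gaps \<open>G i - C i\<close>, with
      geometric weights. The other half pays for keeping only finitely many \<open>C i\<close>,
      since an infinite union of closed sets need not be closed.\<close>
    have "\<exists>C G. closed C \<and> open G \<and> C \<subseteq> A i \<and> A i \<subseteq> G \<and> measure m (G - C) < e / 2 * (1/2) ^ Suc i" for i
      using Union.prems by (intro Union.IH) auto
    then obtain C G where CG: "\<And>i. closed (C i)" "\<And>i. open (G i)" "\<And>i. C i \<subseteq> A i" "\<And>i. A i \<subseteq> G i"
      and small: "\<And>i. measure m (G i - C i) < e / 2 * (1/2) ^ Suc i" by metis
    have bs[measurable]: "C i \<in> sets borel" "G i \<in> sets borel" for i using CG by auto
    have sums: "(\<lambda>i. e / 2 * (1/2) ^ Suc i) sums (e / 2 * 1)"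
      by (intro sums_mult power_half_series)
    have summ: "summable (\<lambda>i. measure m (G i - C i))"
    proof (rule summable_comparison_test'[OF sums_summable[OF sums], of 0])
      show "norm (measure m (G i - C i)) \<le> e / 2 * (1/2) ^ Suc i" for i
        using less_imp_le[OF small[of i]] by (simp del: power_Suc)
    qed
    have "measure m (\<Union>i. G i - C i) \<le> (\<Sum>i. measure m (G i - C i))"
      by (intro finite_measure_subadditive_countably summ) auto
    also have "\<dots> \<le> (\<Sum>i. e / 2 * (1/2) ^ Suc i)"
      by (intro suminf_le summ sums_summable[OF sums] less_imp_le small)
    also have "\<dots> = e / 2" using sums_unique[OF sums] by simp
    finally have 1: "measure m (\<Union>i. G i - C i) \<le> e / 2" .
    define K where "K n = (\<Union>i<n. C i)" for n
    have K: "closed (K n)" for n unfolding K_def using CG by auto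
    have "(\<lambda>n. measure m (K n)) \<longlonglongrightarrow> measure m (\<Union>n. K n)"
      using K by (intro finite_Lim_measure_incseq) (auto simp: incseq_def K_def intro: less_le_trans)
    then have "eventually (\<lambda>n. measure m (\<Union>n. K n) - e / 2 < measure m (K n)) sequentially"
      using Union.prems by (intro order_tendstoD(1)) auto
    then obtain n where n: "measure m (\<Union>n. K n) - e / 2 < measure m (K n)"
      by (auto simp: eventually_sequentially)
    have [measurable]: "K n \<in> sets borel" for n using K by auto
    have 2: "measure m ((\<Union>n. K n) - K n) < e / 2"
      using n by (subst finite_measure_Diff) auto
    have "measure m ((\<Union>i. G i) - K n) \<le> measure m ((\<Union>i. G i - C i) \<union> ((\<Union>n. K n) - K n))"
      by (intro finite_measure_mono) (auto simp: K_def)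
    also have "\<dots> \<le> measure m (\<Union>i. G i - C i) + measure m ((\<Union>n. K n) - K n)"
      by (intro measure_Un_le) auto
    also have "\<dots> < e" using 1 2 by simp
    finally show ?case
      using CG K by (intro exI[of _ "K n"] exI[of _ "\<Union>i. G i"]) (auto simp: K_def, blast+)
  qed
qed

text \<open>Outer regularity of \<open>m\<close>: \<open>A\<close> is enclosed in an open
  \<open>G\<close> with \<open>m (G - A)\<close> small, and the two measures are compared on
  \<open>G\<close>. This turns a Fatou bound, which semicontinuity yields on open sets only, into an
  inequality of measures.\<close>

lemma measure_le_if_le_on_open:
  fixes m n :: "'b::metric_space measure"
  assumes fin: "finite_measure m" and sets_m: "sets m = sets borel" and sets_n: "sets n = sets borel"
    and le: "\<And>G. open G \<Longrightarrow> emeasure n G \<le> emeasure m G"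
  shows "n \<le> m"
proof -
  interpret finite_measure m by fact
  note [simp] = sets_m sets_n
  have "emeasure n A \<le> emeasure m A" for A
  proof (cases "A \<in> sets borel")
    case True
    show ?thesis
    proof (rule ennreal_le_epsilon)
      fix e :: real assume "0 < e"
      from finite_borel_measure_closed_open_approx[OF fin sets_m True this]
      obtain C G where CG: "closed C" "open G" "C \<subseteq> A" "A \<subseteq> G" "measure m (G - C) < e"
        by blast
      have "emeasure n A \<le> emeasure n G" using CG by (intro emeasure_mono) auto
      also have "\<dots> \<le> emeasure m G" using CG by (intro le)
      also have "\<dots> \<le> emeasure m (A \<union> (G - C))" using CG True by (intro emeasure_mono) auto
      also have "\<dots> \<le> emeasure m A + emeasure m (G - C)"
        using CG True by (intro emeasure_subadditive) auto
      also have "\<dots> \<le> emeasure m A + ennreal e"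
        using CG by (intro add_left_mono) (auto simp: emeasure_eq_measure ennreal_leI)
      finally show "emeasure n A \<le> emeasure m A + ennreal e" .
    qed
  qed (simp add: emeasure_notin_sets)
  then show ?thesis
    by (simp add: le_measure_iff sets_eq_imp_space_eq[OF sets_m] sets_eq_imp_space_eq[OF sets_n] le_fun_def)
qed

section \<open>Paths in the one-point compactification\<close>

lemma space_cem_borel [simp]: "space cem_borel = UNIV"
  unfolding cem_borel_def by (simp add: space_measure_of_conv)

lemma openin_cem_Some [simp]: "openin cem_topology (Some ` G) \<longleftrightarrow> open G"
  by (simp add: cem_topology_def)

lemma topspace_cem [simp]: "topspace cem_topology = UNIV"
  unfolding cem_topology_def by (auto simp: notin_range_Some)

text \<open>An open neighbourhood of the cemetery is the complement of the image of a closed set, so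
  images of open sets under \<open>Some\<close> already generate. They are stable under
  intersection, which makes them a family on which kernels can be tested.\<close>

lemma sets_cem_borel:
  "sets cem_borel = sigma_sets UNIV {Some ` G | G :: 'b::topological_space set. open G}" (is "_ = sigma_sets UNIV ?\<G>")
proof -
  have "sets cem_borel = sigma_sets UNIV {U :: 'b option set. openin cem_topology U}"
    unfolding cem_borel_def by (simp add: sets_measure_of_conv)
  also have "\<dots> = sigma_sets UNIV ?\<G>"
  proof (rule sigma_sets_eqI)
    fix U :: "'b option set" assume "U \<in> {U. openin cem_topology U}"
    then have "(\<exists>V. open V \<and> U = Some ` V) \<or> (\<exists>K. closed K \<and> U = insert None (Some ` (- K)))"
      by (auto simp: cem_topology_def openin_Alexandroff_compactification Compl_eq_Diff_UNIV)
    then show "U \<in> sigma_sets UNIV ?\<G>"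
    proof (elim disjE exE conjE)
      fix K :: "'b set" assume K: "closed K" "U = insert None (Some ` (- K))"
      have "U = (UNIV - Some ` UNIV) \<union> Some ` (- K)"
        using K by (auto simp: notin_range_Some)
      also have "\<dots> \<in> sigma_sets UNIV ?\<G>"
        using K by (intro sigma_sets_Un sigma_sets.Compl) (auto intro!: sigma_sets.Basic)
      finally show ?thesis .
    qed auto
  qed auto
  finally show ?thesis .
qed

lemma measurable_cem_borelI:
  assumes "\<And>G. open G \<Longrightarrow> {x \<in> space N. f x \<in> Some ` G} \<in> sets N"
  shows "f \<in> N \<rightarrow>\<^sub>M cem_borel"
proof -
  have "f -` A \<inter> space N \<in> sets N" if "A \<in> {Some ` G | G. open G}" for A
    using that assms by (auto simp: vimage_def Int_def conj_commute)
  then show ?thesis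
    by (intro measurable_sigma_sets[OF sets_cem_borel]) auto
qed

lemma measurable_Some_cem [measurable]: "Some \<in> borel \<rightarrow>\<^sub>M cem_borel"
  by (rule measurable_cem_borelI) (auto simp: inj_image_mem_iff)

lemma sets_cem_borel_Some_open: "open G \<Longrightarrow> Some ` G \<in> sets cem_borel"
  unfolding sets_cem_borel by (auto intro: sigma_sets.Basic)

lemma sets_cem_borel_Some:
  assumes "A \<in> sets borel"
  shows "Some ` A \<in> sets cem_borel"
proof -
  have "A \<in> sigma_sets UNIV (Collect open)"
    using assms by (simp add: borel_def)
  then show ?thesis
  proof induction
    case (Compl A)
    have "Some ` (UNIV - A) = Some ` UNIV - Some ` A" by auto
    then show ?case using Compl sets_cem_borel_Some_open[OF open_UNIV] by auto
  next
    case (Union A)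
    then show ?case by (simp add: image_UN sets.countable_UN)
  qed (auto intro: sets_cem_borel_Some_open)
qed

lemma range_Some_cem [measurable, simp]: "range Some \<in> sets cem_borel"
  by (intro sets_cem_borel_Some_open open_UNIV)

lemma None_cem [measurable, simp]: "{None} \<in> sets cem_borel"
proof -
  have "{None} = UNIV - range Some" by (auto simp: notin_range_Some)
  also have "\<dots> \<in> sets cem_borel"
    using sets.compl_sets[OF range_Some_cem] unfolding space_cem_borel .
  finally show ?thesis .
qed

text \<open>The distance to the complement works, except for the whole space, where
  \<open>infdist\<close> to the empty set would be 0. Such functions let open sets be tested by
  limits along paths.\<close>

lemma open_positive_function:
  fixes G :: "'b::metric_space set"
  assumes "open G"
  obtains f :: "'b \<Rightarrow> real" where "continuous_on UNIV f" "\<And>x. 0 \<le> f x" "\<And>x. 0 < f x \<longleftrightarrow> x \<in> G"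
proof (cases "G = UNIV")
  case True
  then show thesis by (intro that[of "\<lambda>_. 1"]) auto
next
  case False
  have "infdist x (- G) = 0 \<longleftrightarrow> x \<notin> G" for x
    using False assms in_closed_iff_infdist_zero[of "- G" x] by (auto simp: closed_Compl)
  then show thesis
    by (intro that[of "\<lambda>x. infdist x (- G)"] continuous_intros)
       (auto simp: less_le infdist_nonneg)
qed

lemma measurable_cem_borel_option:
  assumes "(\<lambda>x. h (Some x)) \<in> borel \<rightarrow>\<^sub>M N" "h None \<in> space N"
  shows "h \<in> cem_borel \<rightarrow>\<^sub>M N"
proof (rule measurableI)
  fix z show "h z \<in> space N"
    using assms measurable_space[OF assms(1)] by (cases z) auto
next
  fix A assume A: "A \<in> sets N"
  have "h -` A \<inter> space cem_borel =
      Some ` ((\<lambda>x. h (Some x)) -` A) \<union> (if h None \<in> A then {None} else {})"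
  proof (intro set_eqI)
    fix z show "z \<in> h -` A \<inter> space cem_borel \<longleftrightarrow>
      z \<in> Some ` ((\<lambda>x. h (Some x)) -` A) \<union> (if h None \<in> A then {None} else {})"
      by (cases z) auto
  qed
  also have "\<dots> \<in> sets cem_borel"
    using measurable_sets[OF assms(1) A] by (intro sets.Un sets_cem_borel_Some) auto
  finally show "h -` A \<inter> space cem_borel \<in> sets cem_borel" .
qed

lemma measurable_extend0 [measurable]:
  "f \<in> borel_measurable borel \<Longrightarrow> extend0 f \<in> borel_measurable cem_borel"
  by (rule measurable_cem_borel_option) (auto simp: extend0_def)

section \<open>Measurability on path space\<close>

lemma space_path_space [simp]: "space path_space = cadlag_paths"
  unfolding path_space_def by (simp add: space_restrict_space space_PiM PiE_def extensional_def)

lemma cadlag_top [simp]: "w \<in> cadlag_paths \<Longrightarrow> w \<infinity> = None"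
  and cadlag_top' [simp]: "w \<in> cadlag_paths \<Longrightarrow> w top = None"
  by (auto simp: cadlag_paths_def)

text \<open>The cemetery is absorbing on \<open>cadlag_paths\<close>, so a single coordinate decides
  the comparison. This reduces tails of lifetimes to one-dimensional distributions.\<close>

lemma lifetime_le_iff:
  assumes "w \<in> cadlag_paths"
  shows "lifetime w \<le> t \<longleftrightarrow> w t = None"
proof
  show "w t = None" if "lifetime w \<le> t"
    using assms that unfolding cadlag_paths_def by blast
  show "lifetime w \<le> t" if "w t = None"
    unfolding lifetime_def by (rule Inf_lower) (simp add: that)
qed

lemma less_lifetime_iff:
  assumes "w \<in> cadlag_paths"
  shows "t < lifetime w \<longleftrightarrow> w t \<noteq> None"
  using lifetime_le_iff[OF assms] by (auto simp: not_le[symmetric])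

lemma cadlag_right_nhd:
  assumes w: "w \<in> cadlag_paths" and G: "open G" and wt: "w t \<in> Some ` G"
  shows "\<exists>b>t. \<forall>s. t \<le> s \<longrightarrow> s < b \<longrightarrow> w s \<in> Some ` G"
proof -
  have "t \<noteq> \<infinity>" using wt cadlag_top[OF w] by auto
  then have t: "t < \<infinity>" by (simp add: less_top[symmetric])
  then have "limitin cem_topology w (w t) (at_right t)"
    using w unfolding cadlag_paths_def by blast
  then have "eventually (\<lambda>s. w s \<in> Some ` G) (at_right t)"
    using G wt unfolding limitin_def by auto
  then obtain b where "b > t" "\<forall>s>t. s < b \<longrightarrow> w s \<in> Some ` G"
    using eventually_at_right[OF t] by auto
  with wt show ?thesis by (metis le_less)
qed

lemma measurable_eval_path [measurable]: "(\<lambda>w. w t) \<in> path_space \<rightarrow>\<^sub>M cem_borel"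
  unfolding path_space_def by (intro measurable_restrict_space1 measurable_component_singleton) simp

lemma measurable_lifetime [measurable]: "lifetime \<in> borel_measurable path_space"
proof (rule borel_measurableI_le)
  fix t
  have "{w \<in> space path_space. lifetime w \<le> t} = (\<lambda>w. w t) -` {None} \<inter> space path_space"
    by (auto simp: lifetime_le_iff)
  also have "\<dots> \<in> sets path_space"
    by (rule measurable_sets[OF measurable_eval_path None_cem])
  finally show "{w \<in> space path_space. lifetime w \<le> t} \<in> sets path_space" .
qed

subsection \<open>Dyadic approximation of times\<close>

definition grid :: "nat \<Rightarrow> nat \<Rightarrow> ennreal" where
  "grid n k = ennreal (real k / 2 ^ n)"

text \<open>Index of the first dyadic point of level \<open>n\<close> at or above \<open>t\<close>.
  As \<open>enn2real\<close> sends \<infinity> to 0, so does the index; infinite times are therefore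
  treated apart below.\<close>

definition grid_index :: "nat \<Rightarrow> ennreal \<Rightarrow> nat" where
  "grid_index n t = nat \<lceil>enn2real t * 2 ^ n\<rceil>"

lemma measurable_grid_index [measurable]: "grid_index n \<in> borel \<rightarrow>\<^sub>M count_space UNIV"
  unfolding grid_index_def by measurable

lemma grid_less_top [simp]: "grid n k < \<infinity>" "grid n k \<noteq> \<infinity>" "grid n k < top" "grid n k \<noteq> top"
  by (auto simp: grid_def)

lemma grid_0 [simp]: "grid n 0 = 0"
  by (simp add: grid_def)

lemma grid_add: "grid n j + grid n k = grid n (j + k)"
  by (simp add: grid_def add_divide_distrib flip: ennreal_plus)

lemma grid_mono: "j \<le> k \<Longrightarrow> grid n j \<le> grid n k"
  by (auto simp: grid_def intro!: ennreal_leI divide_right_mono)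

lemma le_grid_index:
  assumes "t < \<infinity>" shows "t \<le> grid n (grid_index n t)"
proof -
  obtain r where r: "t = ennreal r" "0 \<le> r" using assms by (cases t) auto
  have "r \<le> real (nat \<lceil>r * 2 ^ n\<rceil>) / 2 ^ n"
    using real_nat_ceiling_ge[of "r * 2 ^ n"] by (simp add: pos_le_divide_eq)
  then show ?thesis using r by (simp add: grid_def grid_index_def ennreal_leI)
qed

lemma grid_index_le_iff:
  assumes "t < \<infinity>" shows "grid_index n t \<le> k \<longleftrightarrow> t \<le> grid n k"
proof -
  obtain r where r: "t = ennreal r" "0 \<le> r" using assms by (cases t) auto
  have "grid_index n t \<le> k \<longleftrightarrow> r * 2 ^ n \<le> real k"
    using r by (simp add: grid_index_def)
  also have "\<dots> \<longleftrightarrow> r \<le> real k / 2 ^ n" by (simp add: pos_le_divide_eq)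
  finally show ?thesis using r by (simp add: grid_def ennreal_le_iff)
qed

lemma grid_index_pos:
  assumes "0 < t" "t < \<infinity>" shows "0 < grid_index n t"
proof -
  have "\<not> grid_index n t \<le> 0"
    using assms by (subst grid_index_le_iff) auto
  then show ?thesis by simp
qed

lemma grid_pred_less:
  assumes "0 < t" "t < \<infinity>" shows "grid n (grid_index n t - 1) < t"
proof -
  have "\<not> grid_index n t \<le> grid_index n t - 1"
    using grid_index_pos[OF assms, of n] by simp
  then show ?thesis
    using grid_index_le_iff[OF assms(2)] by (simp add: not_le)
qed

lemma grid_Suc_double: "grid (Suc n) (2 * k) = grid n k"
  by (simp add: grid_def)

text \<open>Refining the grid keeps the old points, so the last grid point strictly below
  \<open>t\<close> can only move up. Quasi-left-continuity and continuity of measures from above are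
  both applied along this sequence.\<close>

lemma grid_pred_incseq:
  assumes "0 < t" "t < \<infinity>" shows "incseq (\<lambda>n. grid n (grid_index n t - 1))"
proof (rule incseq_SucI)
  fix n
  have "\<not> grid_index (Suc n) t \<le> 2 * (grid_index n t - 1)"
    using grid_index_le_iff[OF assms(2), of "Suc n"] grid_pred_less[OF assms, of n]
    by (simp add: grid_Suc_double)
  then have "grid (Suc n) (2 * (grid_index n t - 1)) \<le> grid (Suc n) (grid_index (Suc n) t - 1)"
    by (intro grid_mono) simp
  then show "grid n (grid_index n t - 1) \<le> grid (Suc n) (grid_index (Suc n) t - 1)"
    by (simp add: grid_Suc_double)
qed

lemma grid_index_tendsto:
  assumes "0 < t" "t < \<infinity>"
  shows "(\<lambda>n. grid n (grid_index n t)) \<longlonglongrightarrow> t"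
    and "(\<lambda>n. grid n (grid_index n t - 1)) \<longlonglongrightarrow> t"
proof -
  have eq: "grid n (grid_index n t) = grid n (grid_index n t - 1) + ennreal ((1/2) ^ n)" for n
    using grid_add[of n "grid_index n t - 1" 1] grid_index_pos[OF assms, of n]
    by (simp add: grid_def power_divide)
  have lim0: "(\<lambda>n. ennreal ((1/2) ^ n)) \<longlonglongrightarrow> 0"
    using tendsto_ennrealI[OF LIMSEQ_power_zero[of "1/2 :: real"]] by simp
  have lim1: "(\<lambda>n. t + ennreal ((1/2) ^ n)) \<longlonglongrightarrow> t"
    using tendsto_add[OF tendsto_const lim0, of t] by simp
  have up: "grid n (grid_index n t) \<le> t + ennreal ((1/2) ^ n)" for n
    unfolding eq[of n] by (rule add_right_mono[OF less_imp_le[OF grid_pred_less[OF assms]]])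
  show "(\<lambda>n. grid n (grid_index n t)) \<longlonglongrightarrow> t"
    by (rule tendsto_sandwich[OF always_eventually always_eventually tendsto_const lim1])
       (use le_grid_index[OF assms(2)] up in blast)+
  have lim2: "(\<lambda>n. t - ennreal ((1/2) ^ n)) \<longlonglongrightarrow> t"
    using tendsto_diff_ennreal[OF tendsto_const lim0, of t] assms by simp
  have low: "t - ennreal ((1/2) ^ n) \<le> grid n (grid_index n t - 1)" for n
    using le_grid_index[OF assms(2), of n] unfolding eq[of n]
    by (simp add: ennreal_minus_le_iff add.commute)
  show "(\<lambda>n. grid n (grid_index n t - 1)) \<longlonglongrightarrow> t"
    by (rule tendsto_sandwich[OF always_eventually always_eventually lim2 tendsto_const])
       (use low grid_pred_less[OF assms] less_imp_le in blast)+
qed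

lemma cadlag_grid_eventually:
  assumes w: "w \<in> cadlag_paths" and G: "open G" and wt: "w t \<in> Some ` G" and t: "0 < t"
  shows "eventually (\<lambda>n. w (grid n (grid_index n t)) \<in> Some ` G) sequentially"
proof -
  have "t \<noteq> \<infinity>" using wt cadlag_top[OF w] by auto
  then have fin: "t < \<infinity>" by (simp add: less_top[symmetric])
  obtain b where b: "b > t" "\<And>s. t \<le> s \<Longrightarrow> s < b \<Longrightarrow> w s \<in> Some ` G"
    using cadlag_right_nhd[OF w G wt] by auto
  show ?thesis
    using order_tendstoD(2)[OF grid_index_tendsto(1)[OF t fin] b(1)]
    by eventually_elim (intro b le_grid_index fin)
qed

text \<open>\<open>extend0 f\<close> may be discontinuous at the cemetery, but a path that is there
  stays there, so the sequence is constant. Elsewhere right-continuity applies, because the grid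
  points lie at or above \<open>t\<close>.\<close>

lemma cadlag_grid_tendsto:
  fixes f :: "'b::metric_space \<Rightarrow> real"
  assumes w: "w \<in> cadlag_paths" and f: "continuous_on UNIV f" and t: "t < \<infinity>"
  shows "(\<lambda>n. extend0 f (w (grid n (grid_index n t)))) \<longlonglongrightarrow> extend0 f (w t)"
proof (cases "t = 0")
  case True
  then show ?thesis by (simp add: grid_index_def)
next
  case False
  show ?thesis
  proof (cases "w t")
    case None
    have "w (grid n (grid_index n t)) = None" for n
      using None lifetime_le_iff[OF w] le_grid_index[OF t, of n] by (metis order_trans)
    then show ?thesis using None by simp
  next
    case (Some y)
    show ?thesis
    proof (rule tendstoI)
      fix e :: real assume "0 < e"
      have "open {x. dist (f x) (f y) < e}"
        by (intro open_Collect_less continuous_intros f)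
      then have "eventually (\<lambda>n. w (grid n (grid_index n t)) \<in> Some ` {x. dist (f x) (f y) < e}) sequentially"
        using \<open>0 < e\<close> Some False by (intro cadlag_grid_eventually w) (auto simp: zero_less_iff_neq_zero)
      then show "eventually (\<lambda>n. dist (extend0 f (w (grid n (grid_index n t)))) (extend0 f (w t)) < e) sequentially"
        by eventually_elim (auto simp: extend0_def Some)
    qed
  qed
qed

text \<open>The survivor is a path evaluated at a random time, which may involve uncountably many
  coordinates. Right-continuity writes the evaluation as a limit of evaluations at the countably
  many dyadic times.\<close>

lemma measurable_eval_path_joint [measurable]:
  "(\<lambda>(w, t). w t) \<in> path_space \<Otimes>\<^sub>M borel \<rightarrow>\<^sub>M (cem_borel :: 'b::metric_space option measure)"
proof (rule measurable_cem_borelI)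
  fix G :: "'b set" assume "open G"
  then obtain f :: "'b \<Rightarrow> real" where f: "continuous_on UNIV f" "\<And>x. 0 \<le> f x" "\<And>x. 0 < f x \<longleftrightarrow> x \<in> G"
    using open_positive_function[of G] by metis
  have [measurable]: "f \<in> borel_measurable borel"
    using f(1) by (rule borel_measurable_continuous_onI)
  \<comment> \<open>At \<infinity> the dyadic approximations would return the starting point, as the
    index there is 0. The value 0 is put in by hand; it agrees with the path being
    \<open>None\<close> at \<infinity>.\<close>
  define h where "h = (\<lambda>(w, t). if t = (\<infinity>::ennreal) then 0 else extend0 f (w t))"
  define h' where "h' n = (\<lambda>(w, t). if t = \<infinity> then 0 else extend0 f (w (grid n (grid_index n t))))" for n
  have [measurable]: "h' n \<in> borel_measurable (path_space \<Otimes>\<^sub>M borel)" for n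
  proof -
    have "(\<lambda>p. extend0 f (fst p (grid n (grid_index n (snd p))))) \<in> borel_measurable (path_space \<Otimes>\<^sub>M borel)"
      by (rule measurable_compose_countable[where g = "\<lambda>p. grid_index n (snd p)"]) measurable
    then show ?thesis unfolding h'_def by measurable
  qed
  have "h \<in> borel_measurable (path_space \<Otimes>\<^sub>M borel)"
  proof (rule borel_measurable_LIMSEQ_real)
    fix p :: "(ennreal \<Rightarrow> 'b option) \<times> ennreal"
    assume "p \<in> space (path_space \<Otimes>\<^sub>M borel)"
    then show "(\<lambda>n. h' n p) \<longlonglongrightarrow> h p"
      using cadlag_grid_tendsto[OF _ f(1)]
      by (auto simp: space_pair_measure h_def h'_def less_top[symmetric] split: prod.splits)
  qed measurable
  then have "{p \<in> space (path_space \<Otimes>\<^sub>M borel). 0 < h p} \<in> sets (path_space \<Otimes>\<^sub>M borel)"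
    by measurable
  also have "{p \<in> space (path_space \<Otimes>\<^sub>M borel). 0 < h p} =
      {p \<in> space (path_space \<Otimes>\<^sub>M borel). (case p of (w, t) \<Rightarrow> w t) \<in> Some ` G}"
    using f(3) by (auto simp: space_pair_measure h_def extend0_def split: option.splits if_splits)
  finally show "{p \<in> space (path_space \<Otimes>\<^sub>M borel). (case p of (w, t) \<Rightarrow> w t) \<in> Some ` G}
      \<in> sets (path_space \<Otimes>\<^sub>M borel)" .
qed

lemma measurable_stage_length [measurable]:
  "(\<lambda>(u, v). stage_length u v) \<in> borel_measurable (path_space \<Otimes>\<^sub>M path_space)"
  unfolding stage_length_def by measurable

lemma measurable_survivor [measurable]:
  "(\<lambda>(u, v). survivor u v) \<in>
    path_space \<Otimes>\<^sub>M path_space \<rightarrow>\<^sub>M (cem_borel :: 'b::metric_space option measure)"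
proof -
  let ?P = "path_space :: (ennreal \<Rightarrow> 'b option) measure"
  have 1: "(\<lambda>p. fst p (lifetime (snd p))) \<in> ?P \<Otimes>\<^sub>M ?P \<rightarrow>\<^sub>M (cem_borel :: 'b option measure)"
    using measurable_compose[OF _ measurable_eval_path_joint, of "\<lambda>p. (fst p, lifetime (snd p))"] by simp
  have 2: "(\<lambda>p. snd p (lifetime (fst p))) \<in> ?P \<Otimes>\<^sub>M ?P \<rightarrow>\<^sub>M (cem_borel :: 'b option measure)"
    using measurable_compose[OF _ measurable_eval_path_joint, of "\<lambda>p. (snd p, lifetime (fst p))"] by simp
  have [measurable]: "(\<lambda>p. lifetime (fst p)) \<in> borel_measurable (?P \<Otimes>\<^sub>M ?P)"
    "(\<lambda>p. lifetime (snd p)) \<in> borel_measurable (?P \<Otimes>\<^sub>M ?P)"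
    by (rule measurable_compose[OF _ measurable_lifetime], simp)+
  have 3: "{p \<in> space (?P \<Otimes>\<^sub>M ?P). lifetime (snd p) < lifetime (fst p)}
      \<in> sets (?P \<Otimes>\<^sub>M ?P)"
    by (rule borel_measurable_less) measurable
  have 4: "{p \<in> space (?P \<Otimes>\<^sub>M ?P). lifetime (fst p) < lifetime (snd p)}
      \<in> sets (?P \<Otimes>\<^sub>M ?P)"
    by (rule borel_measurable_less) measurable
  show ?thesis
    unfolding survivor_def case_prod_beta
    by (intro measurable_If 1 2 3 4 measurable_const) simp
qed

section \<open>One-dimensional distributions of a Hunt process\<close>

context hunt_process
begin

abbreviation Q where "Q \<equiv> path_law P X"

lemma space_P [simp]: "space (P z) = space M"
  by (rule sets_eq_imp_space_eq[OF sets_P])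

lemma measurable_P_cong [measurable_cong]: "sets (P z) = sets M"
  by (rule sets_P)

lemma measurable_X [measurable]: "X t \<in> M \<rightarrow>\<^sub>M cem_borel"
proof (rule measurableI)
  fix A :: "'a option set" assume "A \<in> sets cem_borel"
  from measurable_sets[OF adapted[of t] this] show "X t -` A \<inter> space M \<in> sets M"
    using sets_F[of t] space_F[of t] by auto
qed auto

lemma measurable_X_path [measurable]: "(\<lambda>\<omega> t. X t \<omega>) \<in> M \<rightarrow>\<^sub>M path_space"
  unfolding path_space_def
  by (intro measurable_restrict_space2 measurable_PiM_single') (auto simp: cadlag)

lemma sets_Q [simp, measurable_cong]: "sets (Q z) = sets path_space"
  by (simp add: path_law_def)

lemma space_Q [simp]: "space (Q z) = cadlag_paths"
  by (simp add: path_law_def)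

lemma prob_space_Q: "prob_space (Q z)"
proof -
  have "(\<lambda>\<omega> t. X t \<omega>) \<in> P z \<rightarrow>\<^sub>M path_space" by measurable
  then show ?thesis
    unfolding path_law_def by (rule prob_space.prob_space_distr[OF prob_space_P])
qed

definition law where "law t z = distr (Q z) cem_borel (\<lambda>w. w t)"

lemma sets_law [simp, measurable_cong]: "sets (law t z) = sets cem_borel"
  by (simp add: law_def)

lemma space_law [simp]: "space (law t z) = UNIV"
  by (simp add: law_def)

lemma law_eq: "law t z = distr (P z) cem_borel (X t)"
  unfolding law_def path_law_def by (subst distr_distr) (auto simp: comp_def)

lemma prob_space_law: "prob_space (law t z)"
  unfolding law_def by (rule prob_space.prob_space_distr[OF prob_space_Q]) measurable

lemma emeasure_law:
  "A \<in> sets cem_borel \<Longrightarrow> emeasure (law t z) A = emeasure (P z) {\<omega> \<in> space M. X t \<omega> \<in> A}"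
  unfolding law_eq by (subst emeasure_distr) (auto simp: vimage_def Int_def conj_commute)

lemma measure_law:
  "A \<in> sets cem_borel \<Longrightarrow> measure (law t z) A = measure (P z) {\<omega> \<in> space M. X t \<omega> \<in> A}"
  unfolding measure_def by (simp add: emeasure_law)

lemma nn_integral_law:
  "f \<in> borel_measurable cem_borel \<Longrightarrow> (\<integral>\<^sup>+ a. f a \<partial>law t z) = (\<integral>\<^sup>+ w. f (w t) \<partial>Q z)"
  unfolding law_def by (intro nn_integral_distr) auto

lemma measurable_law [measurable]: "law t \<in> cem_borel \<rightarrow>\<^sub>M prob_algebra cem_borel"
proof (intro measurable_prob_algebraI prob_space_law measurable_subprob_algebra)
  show "subprob_space (law t z)" for z
    by (rule prob_space_imp_subprob_space[OF prob_space_law])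
  show "(\<lambda>z. emeasure (law t z) A) \<in> borel_measurable cem_borel" if "A \<in> sets cem_borel" for A
    unfolding finite_measure.emeasure_eq_measure[OF prob_space.finite_measure[OF prob_space_law]]
    using kernel_measurable[OF that] by (simp add: measure_law that)
qed auto

text \<open>In \<open>z\<close> alone measurability is built into the process; in \<open>t\<close>
  it comes from right-continuity along dyadic times. That limit is taken for continuous integrands,
  so open sets are reached afterwards by increasing approximation.\<close>

lemma measurable_law_joint [measurable]:
  "(\<lambda>(z, t). law t z) \<in> cem_borel \<Otimes>\<^sub>M borel \<rightarrow>\<^sub>M prob_algebra cem_borel"
proof (rule measurable_prob_algebra_generated[OF sets_cem_borel])
  show "Int_stable {Some ` G | G :: 'a set. open G}"
  proof (rule Int_stableI)
    fix A B :: "'a option set" assume "A \<in> {Some ` G | G. open G}" "B \<in> {Some ` G | G. open G}"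
    then obtain G H where "A = Some ` G" "B = Some ` H" "open G" "open H" by auto
    then have "A \<inter> B = Some ` (G \<inter> H)" "open (G \<inter> H)" by auto
    then show "A \<inter> B \<in> {Some ` G | G. open G}" by blast
  qed
  fix A :: "'a option set" assume "A \<in> {Some ` G | G. open G}"
  then obtain G where G: "open G" "A = Some ` G" by auto
  then obtain f :: "'a \<Rightarrow> real" where f: "continuous_on UNIV f" "\<And>x. 0 \<le> f x" "\<And>x. 0 < f x \<longleftrightarrow> x \<in> G"
    using open_positive_function[of G] by metis
  \<comment> \<open>These increase to the indicator of \<open>G\<close> and stay in [0, 1]:
    dominated convergence handles the limit in time, monotone convergence the limit in
    \<open>j\<close>.\<close>
  define g where "g j x = min 1 (real j * f x)" for j x
  have g_cont: "continuous_on UNIV (g j)" for j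
    unfolding g_def by (intro continuous_intros f)
  have [measurable]: "g j \<in> borel_measurable borel" for j
    by (rule borel_measurable_continuous_onI[OF g_cont])
  have g01: "0 \<le> extend0 (g j) z" "extend0 (g j) z \<le> 1" for j z
    using f(2) by (auto simp: g_def extend0_def split: option.splits)
  have meas: "(\<lambda>(z, t). \<integral>\<^sup>+ w. ennreal (extend0 (g j) (w t)) \<partial>Q z) \<in> borel_measurable (cem_borel \<Otimes>\<^sub>M borel)" for j
  proof -
    have 1: "(\<lambda>p. \<integral>\<^sup>+ a. ennreal (extend0 (g j) a) \<partial>law (grid n (grid_index n (snd p))) (fst p))
        \<in> borel_measurable (cem_borel \<Otimes>\<^sub>M borel)" for n
    proof (rule measurable_compose_countable[where g = "\<lambda>p. grid_index n (snd p)"])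
      fix i
      have "(\<lambda>p. law (grid n i) (fst p)) \<in> cem_borel \<Otimes>\<^sub>M borel \<rightarrow>\<^sub>M subprob_algebra cem_borel"
        using measurable_prob_algebraD[OF measurable_law] by measurable
      then show "(\<lambda>p. \<integral>\<^sup>+ a. ennreal (extend0 (g j) a) \<partial>law (grid n i) (fst p))
          \<in> borel_measurable (cem_borel \<Otimes>\<^sub>M borel)"
        by (intro nn_integral_measurable_subprob_algebra2[where N = cem_borel]) measurable
    qed measurable
    define h where "h n p = (if snd p = \<infinity> then 0 else
        \<integral>\<^sup>+ a. ennreal (extend0 (g j) a) \<partial>law (grid n (grid_index n (snd p))) (fst p))" for n p
    have [measurable]: "h n \<in> borel_measurable (cem_borel \<Otimes>\<^sub>M borel)" for n
      unfolding h_def using 1[of n] by measurable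
    show ?thesis
    proof (rule borel_measurable_LIMSEQ_order)
      fix p assume "p \<in> space (cem_borel \<Otimes>\<^sub>M borel :: ('a option \<times> ennreal) measure)"
      obtain z t where p: "p = (z, t)" by (cases p)
      show "(\<lambda>n. h n p) \<longlonglongrightarrow> (case p of (z, t) \<Rightarrow> \<integral>\<^sup>+ w. ennreal (extend0 (g j) (w t)) \<partial>Q z)"
      proof (cases "t = \<infinity>")
        case True
        have "(\<integral>\<^sup>+ w. ennreal (extend0 (g j) (w t)) \<partial>Q z) = (\<integral>\<^sup>+ w. 0 \<partial>Q z)"
          using True by (intro nn_integral_cong) (auto simp: extend0_def)
        then show ?thesis using True by (simp add: p h_def)
      next
        case False
        then have fin: "t < \<infinity>" by (simp add: less_top[symmetric])
        have "(\<lambda>n. \<integral>\<^sup>+ w. ennreal (extend0 (g j) (w (grid n (grid_index n t)))) \<partial>Q z)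
            \<longlonglongrightarrow> (\<integral>\<^sup>+ w. ennreal (extend0 (g j) (w t)) \<partial>Q z)"
        proof (rule nn_integral_dominated_convergence[where w = "\<lambda>_. 1"])
          show "(\<integral>\<^sup>+ w. 1 \<partial>Q z) < \<infinity>"
            using prob_space.emeasure_space_1[OF prob_space_Q[of z]] by simp
          show "AE w in Q z. (\<lambda>n. ennreal (extend0 (g j) (w (grid n (grid_index n t)))))
              \<longlonglongrightarrow> ennreal (extend0 (g j) (w t))"
            by (intro AE_I2 tendsto_ennrealI cadlag_grid_tendsto g_cont fin) simp
          show "AE w in Q z. ennreal (extend0 (g j) (w (grid n (grid_index n t)))) \<le> 1" for n
            using g01 by (intro AE_I2) simp
        qed measurable
        then show ?thesis using False by (simp add: p h_def nn_integral_law)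
      qed
    qed measurable
  qed
  have eq: "emeasure (law t z) A = (SUP j. \<integral>\<^sup>+ w. ennreal (extend0 (g j) (w t)) \<partial>Q z)" for z t
  proof -
    have ind: "indicator A a = (SUP j. ennreal (extend0 (g j) a))" for a
    proof (cases "a \<in> A")
      case True
      then obtain x where x: "a = Some x" "0 < f x" using G f(3) by auto
      obtain j :: nat where "1 < real j * f x"
        using reals_Archimedean3[OF x(2)] by auto
      then have "ennreal (extend0 (g j) a) = 1" using x by (simp add: extend0_def g_def)
      moreover have "ennreal (extend0 (g i) a) \<le> 1" for i using g01 by simp
      ultimately show ?thesis using True
        by (intro antisym) (auto intro!: SUP_least SUP_upper2[of j])
    next
      case False
      then have "extend0 (g j) a = 0" for j
      proof (cases a)
        case (Some x)
        then have "f x = 0" using False G f(2)[of x] f(3)[of x] by auto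
        then show ?thesis by (simp add: Some extend0_def g_def)
      qed (simp add: extend0_def)
      then show ?thesis using False by simp
    qed
    have mono: "incseq (\<lambda>j a. ennreal (extend0 (g j) a))"
    proof -
      have "g i x \<le> g j x" if "i \<le> j" for i j x
        unfolding g_def using that f(2) by (intro min.mono mult_right_mono) auto
      then show ?thesis
        by (auto simp: incseq_def le_fun_def extend0_def intro!: ennreal_leI split: option.splits)
    qed
    have "emeasure (law t z) A = (\<integral>\<^sup>+ a. indicator A a \<partial>law t z)"
      using G by (simp add: sets_cem_borel_Some_open)
    also have "\<dots> = (SUP j. \<integral>\<^sup>+ a. ennreal (extend0 (g j) a) \<partial>law t z)"
      unfolding ind
    proof (rule nn_integral_monotone_convergence_SUP[OF mono])
      have "(\<lambda>a. ennreal (extend0 (g j) a)) \<in> borel_measurable cem_borel" for j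
        by (intro measurable_compose[OF measurable_extend0 measurable_ennreal]) measurable
      then show "(\<lambda>a. ennreal (extend0 (g j) a)) \<in> borel_measurable (law t z)" for j
        unfolding measurable_cong_sets[OF sets_law refl] .
    qed
    finally show ?thesis by (simp add: nn_integral_law)
  qed
  show "(\<lambda>p. emeasure (case p of (z, t) \<Rightarrow> law t z) A) \<in> borel_measurable (cem_borel \<Otimes>\<^sub>M borel)"
    unfolding case_prod_beta eq using meas[unfolded case_prod_beta] by measurable
qed (auto simp: prob_space_law)

section \<open>The law of the lifetime\<close>

definition lifetime_law where "lifetime_law z = distr (Q z) borel lifetime"

lemma sets_lifetime_law [simp, measurable_cong]: "sets (lifetime_law z) = sets borel"
  by (simp add: lifetime_law_def)

lemma prob_space_lifetime_law: "prob_space (lifetime_law z)"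
  unfolding lifetime_law_def by (rule prob_space.prob_space_distr[OF prob_space_Q]) measurable

lemma emeasure_lifetime_law_greaterThan:
  "emeasure (lifetime_law z) {t<..} = emeasure (law t z) (range Some)"
proof -
  have "lifetime -` {t<..} \<inter> space (Q z) = (\<lambda>w. w t) -` range Some \<inter> space (Q z)"
    by (auto simp: less_lifetime_iff notin_range_Some)
  then show ?thesis
    unfolding lifetime_law_def law_def by (simp add: emeasure_distr)
qed

lemma measurable_lifetime_law [measurable]:
  "lifetime_law \<in> cem_borel \<rightarrow>\<^sub>M prob_algebra borel"
proof (rule measurable_prob_algebra_generated)
  show "sets (borel :: ennreal measure) = sigma_sets UNIV (range greaterThan)"
    by (subst borel_Ioi) simp
  show "Int_stable (range greaterThan :: ennreal set set)"
    by (rule Int_stableI) (auto simp: image_iff intro: exI[of _ "max _ _"])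
  fix A :: "ennreal set" assume "A \<in> range greaterThan"
  then obtain t where A: "A = {t<..}" by auto
  have "(\<lambda>z. emeasure (law t z) (range Some)) \<in> borel_measurable cem_borel"
    using measurable_emeasure_kernel[OF measurable_prob_algebraD[OF measurable_law]] by simp
  then show "(\<lambda>z. emeasure (lifetime_law z) A) \<in> borel_measurable cem_borel"
    unfolding A emeasure_lifetime_law_greaterThan .
qed (auto simp: prob_space_lifetime_law)

end

section \<open>One stage of the two-particle system\<close>

text \<open>The case split is needed because \<open>enn2real\<close> would give \<infinity> the
  discount 1, whereas an infinite time must contribute nothing.\<close>

definition discount :: "ennreal \<Rightarrow> ennreal" where
  "discount t = (if t = \<infinity> then 0 else ennreal (exp (- enn2real t)))"

lemma measurable_discount [measurable]: "discount \<in> borel_measurable borel"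
  unfolding discount_def by measurable

lemma discount_0 [simp]: "discount 0 = 1"
  by (simp add: discount_def)

lemma discount_add: "discount (s + t) = discount s * discount t"
  by (cases s; cases t) (auto simp: discount_def exp_add[symmetric] simp flip: ennreal_plus ennreal_mult)

lemma discount_le_1: "discount t \<le> 1"
  by (auto simp: discount_def)

lemma discount_less_1: "0 < t \<Longrightarrow> discount t < 1"
  by (cases t) (auto simp: discount_def ennreal_less_one_iff)

lemma discount_antimono: "s \<le> t \<Longrightarrow> discount t \<le> discount s"
  by (cases s; cases t) (auto simp: discount_def top_unique)

lemma discount_eq_0_iff: "discount t = 0 \<longleftrightarrow> t = \<infinity>"
  by (auto simp: discount_def)

text \<open>Masks the value of \<open>f\<close> at the cemetery, so that a stage without survivor
  contributes 0.\<close>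

abbreviation alive :: "('b option \<Rightarrow> ennreal) \<Rightarrow> 'b option \<Rightarrow> ennreal" where
  "alive f a \<equiv> indicator (range Some) a * f a"

context hunt_process
begin

lemma measurable_law_time [measurable]: "(\<lambda>t. law t z) \<in> borel \<rightarrow>\<^sub>M prob_algebra cem_borel"
  using measurable_compose[OF measurable_Pair[OF measurable_const[of z] measurable_ident] measurable_law_joint]
  by simp

lemma nn_integral_law_measurable:
  assumes "(\<lambda>(p, a). g p a) \<in> borel_measurable (N \<Otimes>\<^sub>M cem_borel)"
    and "h \<in> N \<rightarrow>\<^sub>M cem_borel" "k \<in> N \<rightarrow>\<^sub>M borel"
  shows "(\<lambda>p. \<integral>\<^sup>+ a. g p a \<partial>law (k p) (h p)) \<in> borel_measurable N"
proof (rule nn_integral_measurable_subprob_algebra2[OF assms(1)])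
  have "(\<lambda>p. law (k p) (h p)) \<in> N \<rightarrow>\<^sub>M prob_algebra cem_borel"
    using measurable_compose[OF measurable_Pair[OF assms(2,3)] measurable_law_joint] by simp
  then show "(\<lambda>p. law (k p) (h p)) \<in> N \<rightarrow>\<^sub>M subprob_algebra cem_borel"
    by (rule measurable_prob_algebraD)
qed

text \<open>Fubini: by independence, the position of one particle at the death time of the other is
  the one-dimensional law mixed over the lifetime law. The second half exchanges the
  coordinates.\<close>

lemma nn_integral_survivor:
  assumes g: "(\<lambda>(t, a). g t a) \<in> borel_measurable (borel \<Otimes>\<^sub>M cem_borel)"
  shows "(\<integral>\<^sup>+ p. g (lifetime (snd p)) (fst p (lifetime (snd p))) \<partial>(Q z \<Otimes>\<^sub>M Q z'))
    = (\<integral>\<^sup>+ t. \<integral>\<^sup>+ a. g t a \<partial>law t z \<partial>lifetime_law z')"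
    and "(\<integral>\<^sup>+ p. g (lifetime (fst p)) (snd p (lifetime (fst p))) \<partial>(Q z' \<Otimes>\<^sub>M Q z))
    = (\<integral>\<^sup>+ t. \<integral>\<^sup>+ a. g t a \<partial>law t z \<partial>lifetime_law z')"
proof -
  interpret z: prob_space "Q z" by (rule prob_space_Q)
  interpret z': prob_space "Q z'" by (rule prob_space_Q)
  interpret pair_sigma_finite "Q z" "Q z'" ..
  have ga: "(\<lambda>a. g t a) \<in> borel_measurable cem_borel" for t
    using measurable_compose[OF measurable_Pair[OF measurable_const[of t] measurable_ident] g] by simp
  have inner: "(\<integral>\<^sup>+ u. g (lifetime v) (u (lifetime v)) \<partial>Q z) = (\<integral>\<^sup>+ a. g (lifetime v) a \<partial>law (lifetime v) z)" for v
    by (rule nn_integral_law[symmetric, OF ga])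
  have meas_g: "(\<lambda>t. \<integral>\<^sup>+ a. g t a \<partial>law t z) \<in> borel_measurable borel"
    by (rule nn_integral_law_measurable) (use g in simp_all)
  have outer: "(\<integral>\<^sup>+ v. \<integral>\<^sup>+ a. g (lifetime v) a \<partial>law (lifetime v) z \<partial>Q z')
      = (\<integral>\<^sup>+ t. \<integral>\<^sup>+ a. g t a \<partial>law t z \<partial>lifetime_law z')"
    unfolding lifetime_law_def using meas_g by (subst nn_integral_distr) auto
  have m1: "(\<lambda>p. fst p (lifetime (snd p))) \<in> Q z \<Otimes>\<^sub>M Q z' \<rightarrow>\<^sub>M cem_borel"
    using measurable_compose[OF _ measurable_eval_path_joint, of "\<lambda>p. (fst p, lifetime (snd p))" "Q z \<Otimes>\<^sub>M Q z'"]
    by simp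
  have "(\<lambda>p. g (lifetime (snd p)) (fst p (lifetime (snd p)))) \<in> borel_measurable (Q z \<Otimes>\<^sub>M Q z')"
    using measurable_compose[OF measurable_Pair[OF _ m1] g, of "\<lambda>p. lifetime (snd p)"] by simp
  from nn_integral_snd[OF this]
  show "(\<integral>\<^sup>+ p. g (lifetime (snd p)) (fst p (lifetime (snd p))) \<partial>(Q z \<Otimes>\<^sub>M Q z'))
    = (\<integral>\<^sup>+ t. \<integral>\<^sup>+ a. g t a \<partial>law t z \<partial>lifetime_law z')"
    by (simp add: inner outer)
  have m2: "(\<lambda>p. snd p (lifetime (fst p))) \<in> Q z' \<Otimes>\<^sub>M Q z \<rightarrow>\<^sub>M cem_borel"
    using measurable_compose[OF _ measurable_eval_path_joint, of "\<lambda>p. (snd p, lifetime (fst p))" "Q z' \<Otimes>\<^sub>M Q z"]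
    by simp
  have "(\<lambda>p. g (lifetime (fst p)) (snd p (lifetime (fst p)))) \<in> borel_measurable (Q z' \<Otimes>\<^sub>M Q z)"
    using measurable_compose[OF measurable_Pair[OF _ m2] g, of "\<lambda>p. lifetime (fst p)"] by simp
  from z.nn_integral_fst[OF this]
  show "(\<integral>\<^sup>+ p. g (lifetime (fst p)) (snd p (lifetime (fst p))) \<partial>(Q z' \<Otimes>\<^sub>M Q z))
    = (\<integral>\<^sup>+ t. \<integral>\<^sup>+ a. g t a \<partial>law t z \<partial>lifetime_law z')"
    by (simp add: inner outer)
qed

text \<open>The discounted one-stage kernel of the pair, applied to \<open>f\<close>. Both particles
  restart at the survivor, so later stages only involve its diagonal.\<close>

definition branch_op :: "('a option \<Rightarrow> ennreal) \<Rightarrow> 'a option \<Rightarrow> 'a option \<Rightarrow> ennreal" where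
  "branch_op f z z' =
     (\<integral>\<^sup>+ p. discount (stage_length (fst p) (snd p)) * alive f (survivor (fst p) (snd p)) \<partial>(Q z \<Otimes>\<^sub>M Q z'))"

text \<open>A particle evaluated at the death time of the other is \<open>None\<close> unless it
  lives strictly longer. Hence \<open>alive\<close> selects the right summand by itself and removes
  both in a tie. Only one-dimensional and lifetime laws remain, which is what gives measurability in
  the starting point.\<close>

lemma branch_op_eq:
  assumes f [measurable]: "f \<in> borel_measurable cem_borel"
  shows "branch_op f z z' =
      (\<integral>\<^sup>+ t. discount t * (\<integral>\<^sup>+ a. alive f a \<partial>law t z) \<partial>lifetime_law z')
    + (\<integral>\<^sup>+ t. discount t * (\<integral>\<^sup>+ a. alive f a \<partial>law t z') \<partial>lifetime_law z)"
proof -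
  let ?g = "\<lambda>t a. discount t * alive f a"
  have inner: "(\<integral>\<^sup>+ a. ?g t a \<partial>law t y) = discount t * (\<integral>\<^sup>+ a. alive f a \<partial>law t y)" for t y
    by (intro nn_integral_cmult) (simp add: measurable_cong_sets[OF sets_law refl])
  have g: "(\<lambda>(t, a). ?g t a) \<in> borel_measurable (borel \<Otimes>\<^sub>M cem_borel)"
    by measurable
  have m1: "(\<lambda>p. fst p (lifetime (snd p))) \<in> Q z \<Otimes>\<^sub>M Q z' \<rightarrow>\<^sub>M cem_borel"
    using measurable_compose[OF _ measurable_eval_path_joint, of "\<lambda>p. (fst p, lifetime (snd p))" "Q z \<Otimes>\<^sub>M Q z'"]
    by simp
  have m2: "(\<lambda>p. snd p (lifetime (fst p))) \<in> Q z \<Otimes>\<^sub>M Q z' \<rightarrow>\<^sub>M cem_borel"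
    using measurable_compose[OF _ measurable_eval_path_joint, of "\<lambda>p. (snd p, lifetime (fst p))" "Q z \<Otimes>\<^sub>M Q z'"]
    by simp
  have "discount (stage_length u v) * alive f (survivor u v)
      = ?g (lifetime v) (u (lifetime v)) + ?g (lifetime u) (v (lifetime u))"
    if "u \<in> cadlag_paths" "v \<in> cadlag_paths" for u v
    using that less_lifetime_iff[of u "lifetime v"] less_lifetime_iff[of v "lifetime u"]
    by (cases "lifetime u" "lifetime v" rule: linorder_cases)
       (auto simp: stage_length_def survivor_def min_def notin_range_Some)
  then have "branch_op f z z' = (\<integral>\<^sup>+ p. ?g (lifetime (snd p)) (fst p (lifetime (snd p)))
      + ?g (lifetime (fst p)) (snd p (lifetime (fst p))) \<partial>(Q z \<Otimes>\<^sub>M Q z'))"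
    unfolding branch_op_def by (intro nn_integral_cong) (auto simp: space_pair_measure)
  also have "\<dots> = (\<integral>\<^sup>+ p. ?g (lifetime (snd p)) (fst p (lifetime (snd p))) \<partial>(Q z \<Otimes>\<^sub>M Q z'))
      + (\<integral>\<^sup>+ p. ?g (lifetime (fst p)) (snd p (lifetime (fst p))) \<partial>(Q z \<Otimes>\<^sub>M Q z'))"
  proof (rule nn_integral_add)
    show "(\<lambda>p. ?g (lifetime (snd p)) (fst p (lifetime (snd p)))) \<in> borel_measurable (Q z \<Otimes>\<^sub>M Q z')"
      using measurable_compose[OF measurable_Pair[OF _ m1] g, of "\<lambda>p. lifetime (snd p)"] by simp
    show "(\<lambda>p. ?g (lifetime (fst p)) (snd p (lifetime (fst p)))) \<in> borel_measurable (Q z \<Otimes>\<^sub>M Q z')"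
      using measurable_compose[OF measurable_Pair[OF _ m2] g, of "\<lambda>p. lifetime (fst p)"] by simp
  qed
  also have "\<dots> = (\<integral>\<^sup>+ t. \<integral>\<^sup>+ a. ?g t a \<partial>law t z \<partial>lifetime_law z')
      + (\<integral>\<^sup>+ t. \<integral>\<^sup>+ a. ?g t a \<partial>law t z' \<partial>lifetime_law z)"
    by (simp only: nn_integral_survivor[OF g])
  finally show ?thesis unfolding inner .
qed

lemma measurable_branch_op_diag [measurable]:
  assumes f [measurable]: "f \<in> borel_measurable cem_borel"
  shows "(\<lambda>z. branch_op f z z) \<in> borel_measurable cem_borel"
proof -
  have *: "(\<lambda>p. \<integral>\<^sup>+ a. alive f a \<partial>law (snd p) (fst p)) \<in> borel_measurable (cem_borel \<Otimes>\<^sub>M borel)"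
    by (rule nn_integral_law_measurable) measurable
  have "(\<lambda>p. discount (snd p)) \<in> borel_measurable (cem_borel \<Otimes>\<^sub>M borel :: ('a option \<times> ennreal) measure)"
    by measurable
  then have "(\<lambda>(z, t). discount t * (\<integral>\<^sup>+ a. alive f a \<partial>law t z)) \<in> borel_measurable (cem_borel \<Otimes>\<^sub>M borel)"
    unfolding case_prod_beta using * by (rule borel_measurable_times_ennreal)
  then have [measurable]: "(\<lambda>z. \<integral>\<^sup>+ t. discount t * (\<integral>\<^sup>+ a. alive f a \<partial>law t z) \<partial>lifetime_law z)
      \<in> borel_measurable cem_borel"
    by (rule nn_integral_measurable_subprob_algebra2[OF _ measurable_prob_algebraD[OF measurable_lifetime_law]])
  show ?thesis unfolding branch_op_eq[OF f] by measurable
qed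

end

section \<open>Markov property and self-duality\<close>

context hunt_process
begin

lemma law_0: "law 0 z = return cem_borel z"
proof -
  interpret prob_space "P z" by (rule prob_space_P)
  have "law 0 z = distr (P z) cem_borel (\<lambda>_. z)"
    unfolding law_eq
    using normal[of z] by (intro distr_cong_AE) (auto simp: eq_commute)
  then show ?thesis by simp
qed

lemma AE_lifetime_law_pos: "AE t in lifetime_law (Some x). 0 < t"
proof -
  interpret prob_space "lifetime_law (Some x)" by (rule prob_space_lifetime_law)
  have "emeasure (lifetime_law (Some x)) {0<..} = 1"
    unfolding emeasure_lifetime_law_greaterThan law_0 by simp
  then have "prob {0<..} = 1" by (simp add: measure_def)
  then show ?thesis by (subst (asm) prob_eq_1) auto
qed

lemma X_eq_None_mono:
  "\<omega> \<in> space M \<Longrightarrow> X s \<omega> = None \<Longrightarrow> s \<le> t \<Longrightarrow> X t \<omega> = None"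
  using lifetime_le_iff[OF cadlag] by (metis order_trans)

lemma measure_law_None: "A \<in> sets borel \<Longrightarrow> measure (law t None) (Some ` A) = 0"
proof -
  assume A: "A \<in> sets borel"
  have "AE \<omega> in P None. \<omega> \<in> space M" using AE_space[of "P None"] by simp
  with normal[of None] have "AE \<omega> in P None. \<not> X t \<omega> \<in> Some ` A"
    by eventually_elim (use X_eq_None_mono[of _ 0 t] in force)
  then have "emeasure (P None) {\<omega> \<in> space (P None). X t \<omega> \<in> Some ` A} = 0"
    by (rule emeasure_eq_0_AE)
  then show ?thesis
    using A by (simp add: measure_law sets_cem_borel_Some measure_def[of "P None"])
qed

text \<open>The strong Markov property at a constant time, integrated: a conditional expectation has
  the same mean as its integrand.\<close>

lemma markov:
  assumes t: "t < \<infinity>" and A: "A \<in> sets cem_borel"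
  shows "measure (law (s + t) z) A = (\<integral>\<omega>. measure (law t (X s \<omega>)) A \<partial>P z)"
proof -
  interpret prob_space "P z" by (rule prob_space_P)
  let ?T = "\<lambda>_ :: 'w. s"
  have stop: "stopping_time F ?T" by (rule stopping_time_const)
  have "B \<in> sets M" if B: "B \<in> sets (pre_sigma ?T)" for B
  proof -
    \<comment> \<open>Testing the stopped sigma-algebra at time \<infinity> places it inside
      \<open>F \<infinity>\<close>.\<close>
    have "{\<omega> \<in> B. s \<le> \<infinity>} \<in> sets (F \<infinity>)"
      using sets_pre_sigmaD[OF stop B, of \<infinity>] by simp
    then show ?thesis using sets_F[of \<infinity>] by auto
  qed
  then have sub: "subalgebra (P z) (pre_sigma ?T)"
    by (auto simp: subalgebra_def space_pre_sigma sets_P)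
  then interpret finite_measure_subalgebra "P z" "pre_sigma ?T"
    by (intro finite_measure_subalgebra.intro finite_measure_axioms finite_measure_subalgebra_axioms.intro)
  let ?I = "{\<omega> \<in> space M. X (s + t) \<omega> \<in> A}"
  have I: "?I \<in> sets M"
    using measurable_sets[OF measurable_X A] by (simp add: vimage_def Int_def conj_commute)
  have int: "integrable (P z) (indicator ?I :: _ \<Rightarrow> real)"
    using I by (intro integrable_real_indicator) (auto simp: sets_P emeasure_eq_measure)
  have "measure (law (s + t) z) A = (\<integral>\<omega>. indicator ?I \<omega> \<partial>P z)"
    using A I by (simp add: measure_law sets_P Int_absorb1 sets.sets_into_space[OF I])
  also have "\<dots> = (\<integral>\<omega>. real_cond_exp (P z) (pre_sigma ?T) (indicator ?I) \<omega> \<partial>P z)"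
    by (rule real_cond_exp_int(2)[OF int, symmetric])
  also have "\<dots> = (\<integral>\<omega>. measure (law t (X s \<omega>)) A \<partial>P z)"
  proof (rule integral_cong_AE)
    show "AE \<omega> in P z. real_cond_exp (P z) (pre_sigma ?T) (indicator ?I) \<omega> = measure (law t (X s \<omega>)) A"
      using strong_markov[OF stop t A, of z] by (simp add: measure_law A)
    have "(\<lambda>z. measure (law t z) A) \<in> borel_measurable cem_borel"
      using kernel_measurable[OF A, of t] by (simp add: measure_law A)
    from measurable_compose[OF measurable_X this]
    show "(\<lambda>\<omega>. measure (law t (X s \<omega>)) A) \<in> borel_measurable (P z)" by simp
    show "real_cond_exp (P z) (pre_sigma ?T) (indicator ?I) \<in> borel_measurable (P z)"
      by (rule real_cond_exp_int(1)[OF int, THEN borel_measurable_integrable])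
  qed
  finally show ?thesis .
qed

section \<open>The semigroup on indicators and its duality pairing\<close>

definition hit :: "'a set \<Rightarrow> ennreal \<Rightarrow> 'a \<Rightarrow> real" where
  "hit G t x = measure (law t (Some x)) (Some ` G)"

lemma hit_nonneg: "0 \<le> hit G t x"
  and hit_le_1: "hit G t x \<le> 1"
  by (simp_all add: hit_def prob_space.prob_le_1[OF prob_space_law])

lemma measurable_hit [measurable]:
  assumes "G \<in> sets borel" shows "hit G t \<in> borel_measurable borel"
proof -
  have "(\<lambda>z. measure (law t z) (Some ` G)) \<in> borel_measurable cem_borel"
    using kernel_measurable[OF sets_cem_borel_Some[OF assms], of t] sets_cem_borel_Some[OF assms]
    by (simp add: measure_law)
  from measurable_compose[OF measurable_Some_cem this] show ?thesis
    by (simp add: hit_def[abs_def])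
qed

lemma ennreal_hit: "ennreal (hit G t x) = emeasure (law t (Some x)) (Some ` G)"
  unfolding hit_def
  by (rule finite_measure.emeasure_eq_measure[OF prob_space.finite_measure[OF prob_space_law], symmetric])

lemma hit_0: "G \<in> sets borel \<Longrightarrow> hit G 0 x = indicator G x"
  by (simp add: hit_def law_0 measure_return sets_cem_borel_Some indicator_def inj_image_mem_iff)

text \<open>Chapman-Kolmogorov. Extending \<open>hit G t\<close> by 0 is consistent because
  \<open>D\<close> is almost surely never reached from the cemetery.\<close>

lemma hit_add:
  assumes t: "t < \<infinity>" and G: "G \<in> sets borel"
  shows "transition_op P X s (hit G t) x = hit G (s + t) x"
proof -
  have "extend0 (hit G t) z = measure (law t z) (Some ` G)" for z
    by (cases z) (simp_all add: extend0_def hit_def measure_law_None G)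
  then show ?thesis
    unfolding transition_op_def hit_def by (simp add: markov[OF t] sets_cem_borel_Some G)
qed

lemma transition_op_1: "transition_op P X s (\<lambda>_. 1) x = hit UNIV s x"
proof -
  have *: "range Some \<in> sets cem_borel" by simp
  have I: "{\<omega> \<in> space M. X s \<omega> \<in> range Some} \<in> sets M"
    using measurable_sets[OF measurable_X *] by (simp add: vimage_def Int_def conj_commute)
  have "transition_op P X s (\<lambda>_. 1) x
      = (\<integral>\<omega>. indicator {\<omega> \<in> space M. X s \<omega> \<in> range Some} \<omega> \<partial>P (Some x))"
    unfolding transition_op_def
  proof (rule Bochner_Integration.integral_cong[OF refl])
    fix \<omega> assume "\<omega> \<in> space (P (Some x))"
    then show "extend0 (\<lambda>_. 1) (X s \<omega>) = (indicator {\<omega> \<in> space M. X s \<omega> \<in> range Some} \<omega> :: real)"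
      by (cases "X s \<omega>") (auto simp: extend0_def)
  qed
  also have "\<dots> = hit UNIV s x"
    using I by (simp add: hit_def measure_law sets_P Int_absorb1 sets.sets_into_space)
  finally show ?thesis .
qed

end

locale self_dual_hunt_process = hunt_process M F P X
  for M :: "'w measure" and F
    and P :: "'a::{metric_space, second_countable_topology} option \<Rightarrow> 'w measure" and X +
  fixes m :: "'a measure"
  assumes self_dual: "self_dual P X m" and finite_m: "finite_measure m"
begin

sublocale m: finite_measure m by (rule finite_m)

lemma sets_m [simp, measurable_cong]: "sets m = sets borel"
  using self_dual by (simp add: self_dual_def)

lemma space_m [simp]: "space m = UNIV"
  using sets_eq_imp_space_eq[OF sets_m] by simp

lemma integrable_bounded:
  fixes f :: "'a \<Rightarrow> real"
  assumes "f \<in> borel_measurable borel" "\<And>x. \<bar>f x\<bar> \<le> B"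
  shows "integrable m f"
  using assms by (intro m.integrable_const_bound[of _ B]) (auto simp: measurable_cong_sets[OF sets_m refl])

lemma integrable_hit: "G \<in> sets borel \<Longrightarrow> integrable m (hit G t)"
  by (intro integrable_bounded[of _ 1] measurable_hit) (simp_all add: hit_nonneg hit_le_1)

lemma integrable_hit_mult:
  "G \<in> sets borel \<Longrightarrow> integrable m (\<lambda>x. hit UNIV s x * hit G t x)"
  using hit_nonneg hit_le_1
  by (intro integrable_bounded[of _ 1] borel_measurable_times measurable_hit)
     (auto simp: abs_mult intro!: mult_le_one)

text \<open>Self-duality tested on the constant 1 and on \<open>hit G t\<close>. The right side
  depends on \<open>s\<close> and \<open>t\<close> only through their sum, which drives both the
  telescoping and the convexity argument.\<close>

lemma hit_duality:
  assumes s: "s < \<infinity>" and t: "t < \<infinity>" and G: "G \<in> sets borel"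
  shows "(\<integral>x. hit UNIV s x * hit G t x \<partial>m) = (\<integral>x. hit G (s + t) x \<partial>m)"
proof -
  have 1: "(\<lambda>_. 1) \<in> L2 m" by (simp add: L2_def)
  have "(\<lambda>x. (hit G t x)\<^sup>2) \<in> borel_measurable borel"
    using G by measurable
  then have 2: "hit G t \<in> L2 m"
    unfolding L2_def using G hit_nonneg hit_le_1
    by (auto simp: measurable_cong_sets[OF sets_m refl] power_le_one intro!: integrable_bounded[of _ 1])
  have "(\<integral>x. transition_op P X s (\<lambda>_. 1) x * hit G t x \<partial>m) = (\<integral>x. 1 * transition_op P X s (hit G t) x \<partial>m)"
    using self_dual s 1 2 unfolding self_dual_def by blast
  moreover have "transition_op P X s (hit G t) = hit G (s + t)"
    by (rule ext) (rule hit_add[OF t G])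
  ultimately show ?thesis by (simp add: transition_op_1)
qed

text \<open>The pairing <1, P_t f> with \<open>f\<close> the indicator of \<open>G\<close>, as a
  function of time.\<close>

definition mass :: "'a set \<Rightarrow> ennreal \<Rightarrow> real" where
  "mass G t = (\<integral>x. hit G t x \<partial>m)"

lemma mass_nonneg: "0 \<le> mass G t"
  unfolding mass_def by (intro integral_nonneg_AE AE_I2 hit_nonneg)

lemma mass_0: "G \<in> sets borel \<Longrightarrow> mass G 0 = measure m G"
  by (simp add: mass_def hit_0)

end

section \<open>The reference measure is subinvariant under branching\<close>

context hunt_process
begin

lemma emeasure_law_nn_integral:
  assumes "A \<in> sets cem_borel"
  shows "emeasure (law t z) A = (\<integral>\<^sup>+ \<omega>. indicator A (X t \<omega>) \<partial>P z)"
proof -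
  have "(\<integral>\<^sup>+ \<omega>. indicator A (X t \<omega>) \<partial>P z) = (\<integral>\<^sup>+ a. indicator A a \<partial>law t z)"
    unfolding law_eq using assms by (subst nn_integral_distr) auto
  then show ?thesis using assms by simp
qed

text \<open>Quasi-left-continuity is what allows the approximation from the left.\<close>

lemma law_lower_semicontinuous:
  assumes t: "0 < t" "t < \<infinity>" and G: "open G"
  shows "2 * emeasure (law t z) (Some ` G) \<le>
    liminf (\<lambda>n. emeasure (law (grid n (grid_index n t - 1)) z) (Some ` G)
              + emeasure (law (grid n (grid_index n t)) z) (Some ` G))"
proof -
  let ?A = "Some ` G"
  have A: "?A \<in> sets cem_borel" by (rule sets_cem_borel_Some_open[OF G])
  have ind [measurable]: "(\<lambda>\<omega>. indicator ?A (X s \<omega>) :: ennreal) \<in> borel_measurable (P z)" for s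
  proof -
    have "indicator ?A \<in> borel_measurable (cem_borel :: 'a option measure)"
      using A by (rule borel_measurable_indicator)
    from measurable_compose[OF measurable_X this, of s] show ?thesis
      by (simp add: measurable_cong_sets[OF sets_P refl])
  qed
  let ?l = "\<lambda>n. grid n (grid_index n t - 1)" and ?r = "\<lambda>n. grid n (grid_index n t)"
  have inc: "incseq ?l" by (rule grid_pred_incseq[OF t])
  have sup: "(SUP n. ?l n) = t"
    by (rule LIMSEQ_unique[OF LIMSEQ_SUP[OF inc] grid_index_tendsto(2)[OF t]])
  \<comment> \<open>The left grid points are deterministic, hence stopping times, and increase to
    \<open>t\<close>. So along them the process almost surely converges to its value at
    \<open>t\<close> itself.\<close>
  have "AE \<omega> in P z. (SUP n. ?l n) < \<infinity> \<longrightarrow>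
        limitin cem_topology (\<lambda>n. X (?l n) \<omega>) (X (SUP n. ?l n) \<omega>) sequentially"
    by (rule quasi_left_continuous[OF stopping_time_const inc])
  then have left: "AE \<omega> in P z. limitin cem_topology (\<lambda>n. X (?l n) \<omega>) (X t \<omega>) sequentially"
    unfolding sup using t(2) by simp
  have "AE \<omega> in P z. 2 * indicator ?A (X t \<omega>)
      \<le> (liminf (\<lambda>n. indicator ?A (X (?l n) \<omega>) + indicator ?A (X (?r n) \<omega>)) :: ennreal)"
    using left AE_space
  proof eventually_elim
    case (elim \<omega>)
    show ?case
    proof (cases "X t \<omega> \<in> ?A")
      case True
      have 1: "eventually (\<lambda>n. X (?l n) \<omega> \<in> ?A) sequentially"
        using elim(1) True G unfolding limitin_def by auto
      have "(\<lambda>t. X t \<omega>) \<in> cadlag_paths" using elim(2) by (intro cadlag) simp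
      from cadlag_grid_eventually[OF this G True t(1)]
      have 2: "eventually (\<lambda>n. X (?r n) \<omega> \<in> ?A) sequentially" .
      have "eventually (\<lambda>n. 2 * indicator ?A (X t \<omega>)
          \<le> (indicator ?A (X (?l n) \<omega>) + indicator ?A (X (?r n) \<omega>) :: ennreal)) sequentially"
        using 1 2 by eventually_elim (use True in simp)
      then show ?thesis by (rule Liminf_bounded)
    qed simp
  qed
  then have "(\<integral>\<^sup>+ \<omega>. 2 * indicator ?A (X t \<omega>) \<partial>P z)
      \<le> (\<integral>\<^sup>+ \<omega>. liminf (\<lambda>n. indicator ?A (X (?l n) \<omega>) + indicator ?A (X (?r n) \<omega>)) \<partial>P z)"
    by (rule nn_integral_mono_AE)
  also have "\<dots> \<le> liminf (\<lambda>n. \<integral>\<^sup>+ \<omega>. indicator ?A (X (?l n) \<omega>) + indicator ?A (X (?r n) \<omega>) \<partial>P z)"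
    by (intro nn_integral_liminf borel_measurable_add ind)
  finally show ?thesis
    by (simp only: nn_integral_add[OF ind ind] nn_integral_cmult[OF ind] emeasure_law_nn_integral[OF A])
qed

text \<open>Twice a trapezoidal approximation of the mass that the law at time \<open>t\<close>
  gives to \<open>G\<close>. As a step function of \<open>t\<close> it integrates against the
  lifetime law to a series of increments.\<close>

definition dyadic_sum :: "'a set \<Rightarrow> nat \<Rightarrow> 'a option \<Rightarrow> ennreal \<Rightarrow> ennreal" where
  "dyadic_sum G n z t = (\<Sum>k. indicator {grid n k<..grid n (Suc k)} t *
     (emeasure (law (grid n k) z) (Some ` G) + emeasure (law (grid n (Suc k)) z) (Some ` G)))"

lemma dyadic_sum_ge:
  assumes t: "0 < t" "t < \<infinity>"
  shows "emeasure (law (grid n (grid_index n t - 1)) z) (Some ` G)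
       + emeasure (law (grid n (grid_index n t)) z) (Some ` G) \<le> dyadic_sum G n z t"
proof -
  let ?k = "grid_index n t - 1"
  have k: "Suc ?k = grid_index n t" using grid_index_pos[OF t, of n] by simp
  define f where "f k = indicator {grid n k<..grid n (Suc k)} t *
     (emeasure (law (grid n k) z) (Some ` G) + emeasure (law (grid n (Suc k)) z) (Some ` G))" for k
  have "t \<in> {grid n ?k<..grid n (Suc ?k)}"
    unfolding k using grid_pred_less[OF t] le_grid_index[OF t(2)] by simp
  then have "emeasure (law (grid n ?k) z) (Some ` G)
       + emeasure (law (grid n (grid_index n t)) z) (Some ` G) = f ?k"
    by (simp only: f_def k indicator_simps mult_1)
  also have "f ?k = sum f {?k}" by simp
  also have "\<dots> \<le> (\<Sum>k. f k)" by (rule sum_le_suminf) auto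
  finally show ?thesis unfolding dyadic_sum_def f_def .
qed

lemma measurable_emeasure_law_time [measurable]:
  "A \<in> sets cem_borel \<Longrightarrow> (\<lambda>t. emeasure (law t z) A) \<in> borel_measurable borel"
  using measurable_emeasure_kernel[OF measurable_prob_algebraD[OF measurable_law_time]] .

lemma law_infinity: "A \<in> sets borel \<Longrightarrow> emeasure (law \<infinity> z) (Some ` A) = 0"
proof -
  assume A: "A \<in> sets borel"
  have *: "{\<omega> \<in> space M. X \<infinity> \<omega> \<in> Some ` A} = {}"
    using cadlag_top[OF cadlag] by force
  show ?thesis unfolding emeasure_law[OF sets_cem_borel_Some[OF A]] * by simp
qed

text \<open>Fatou in the death time. The extreme times are harmless: 0 has probability 0, and at
  \<infinity> the other particle is at the cemetery.\<close>

lemma branching_le_liminf_dyadic_sum: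
  assumes G: "open G"
  shows "(\<integral>\<^sup>+ t. 2 * emeasure (law t (Some x)) (Some ` G) \<partial>lifetime_law (Some x))
    \<le> liminf (\<lambda>n. \<integral>\<^sup>+ t. dyadic_sum G n (Some x) t \<partial>lifetime_law (Some x))"
proof -
  have "AE t in lifetime_law (Some x).
      2 * emeasure (law t (Some x)) (Some ` G) \<le> liminf (\<lambda>n. dyadic_sum G n (Some x) t)"
    using AE_lifetime_law_pos[of x]
  proof eventually_elim
    case (elim t)
    show ?case
    proof (cases "t = \<infinity>")
      case True
      then show ?thesis using G by (simp add: law_infinity del: infinity_ennreal_def)
    next
      case False
      then have t: "0 < t" "t < \<infinity>" using elim by (simp_all add: less_top[symmetric])
      show ?thesis
        by (rule order_trans[OF law_lower_semicontinuous[OF t G]])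
           (intro Liminf_mono always_eventually allI dyadic_sum_ge t)
    qed
  qed
  then have "(\<integral>\<^sup>+ t. 2 * emeasure (law t (Some x)) (Some ` G) \<partial>lifetime_law (Some x))
      \<le> (\<integral>\<^sup>+ t. liminf (\<lambda>n. dyadic_sum G n (Some x) t) \<partial>lifetime_law (Some x))"
    by (rule nn_integral_mono_AE)
  also have "\<dots> \<le> liminf (\<lambda>n. \<integral>\<^sup>+ t. dyadic_sum G n (Some x) t \<partial>lifetime_law (Some x))"
    unfolding dyadic_sum_def[abs_def] by (intro nn_integral_liminf) measurable
  finally show ?thesis .
qed

lemma emeasure_lifetime_law_Ioc:
  assumes "s \<le> t"
  shows "emeasure (lifetime_law (Some x)) {s<..t} = ennreal (hit UNIV s x - hit UNIV t x)"
proof -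
  interpret prob_space "lifetime_law (Some x)" by (rule prob_space_lifetime_law)
  have "{s<..t} = {s<..} - {t<..}" by auto
  then have "emeasure (lifetime_law (Some x)) {s<..t}
      = emeasure (lifetime_law (Some x)) {s<..} - emeasure (lifetime_law (Some x)) {t<..}"
    using assms by (simp add: emeasure_Diff)
  also have "\<dots> = ennreal (hit UNIV s x - hit UNIV t x)"
    unfolding emeasure_lifetime_law_greaterThan ennreal_hit[symmetric]
    by (rule ennreal_minus[OF hit_nonneg])
  finally show ?thesis .
qed

lemma hit_UNIV_antimono: "s \<le> t \<Longrightarrow> hit UNIV t x \<le> hit UNIV s x"
proof -
  assume "s \<le> t"
  then have "emeasure (lifetime_law (Some x)) {t<..} \<le> emeasure (lifetime_law (Some x)) {s<..}"
    by (intro emeasure_mono) auto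
  then show ?thesis
    unfolding emeasure_lifetime_law_greaterThan ennreal_hit[symmetric]
    by (simp add: ennreal_le_iff hit_nonneg)
qed

lemma nn_integral_dyadic_sum:
  "(\<integral>\<^sup>+ t. dyadic_sum G n (Some x) t \<partial>lifetime_law (Some x)) =
    (\<Sum>k. ennreal ((hit UNIV (grid n k) x - hit UNIV (grid n (Suc k)) x) *
       (hit G (grid n k) x + hit G (grid n (Suc k)) x)))"
proof -
  have "(\<integral>\<^sup>+ t. dyadic_sum G n (Some x) t \<partial>lifetime_law (Some x)) =
    (\<Sum>k. \<integral>\<^sup>+ t. indicator {grid n k<..grid n (Suc k)} t *
     (emeasure (law (grid n k) (Some x)) (Some ` G) + emeasure (law (grid n (Suc k)) (Some x)) (Some ` G))
       \<partial>lifetime_law (Some x))"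
    unfolding dyadic_sum_def by (intro nn_integral_suminf) measurable
  also have "\<dots> = (\<Sum>k. emeasure (lifetime_law (Some x)) {grid n k<..grid n (Suc k)} *
     (emeasure (law (grid n k) (Some x)) (Some ` G) + emeasure (law (grid n (Suc k)) (Some x)) (Some ` G)))"
    by (subst nn_integral_multc) auto
  also have "\<dots> = (\<Sum>k. ennreal ((hit UNIV (grid n k) x - hit UNIV (grid n (Suc k)) x) *
       (hit G (grid n k) x + hit G (grid n (Suc k)) x)))"
    using hit_UNIV_antimono[OF grid_mono] hit_nonneg
    by (simp add: emeasure_lifetime_law_Ioc grid_mono ennreal_hit[symmetric] ennreal_mult
        flip: ennreal_plus)
  finally show ?thesis .
qed

end

context self_dual_hunt_process
begin

text \<open>Evaluating the conditional expectations at both endpoints of each dyadic interval makes the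
  sum telescope: by duality its \<open>k\<close>-th term integrates to
  \<open>mass G (2 k / 2 ^ n) - mass G ((2 k + 2) / 2 ^ n)\<close>.\<close>

lemma nn_integral_dyadic_sum_le:
  assumes G: "G \<in> sets borel"
  shows "(\<integral>\<^sup>+ x. \<integral>\<^sup>+ t. dyadic_sum G n (Some x) t \<partial>lifetime_law (Some x) \<partial>m) \<le> emeasure m G"
proof -
  let ?d = "\<lambda>k x. (hit UNIV (grid n k) x - hit UNIV (grid n (Suc k)) x) *
       (hit G (grid n k) x + hit G (grid n (Suc k)) x)"
  let ?b = "\<lambda>j. mass G (grid n j)"
  have d_nonneg: "0 \<le> ?d k x" for k x
    using hit_UNIV_antimono[OF grid_mono[of k "Suc k" n]] hit_nonneg by (intro mult_nonneg_nonneg) auto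
  have d_eq: "?d k x = hit UNIV (grid n k) x * hit G (grid n k) x
      + hit UNIV (grid n k) x * hit G (grid n (Suc k)) x
      - hit UNIV (grid n (Suc k)) x * hit G (grid n k) x
      - hit UNIV (grid n (Suc k)) x * hit G (grid n (Suc k)) x" for k x
    by (simp add: algebra_simps)
  have int: "integrable m (?d k)" for k
    unfolding d_eq by (intro Bochner_Integration.integrable_add Bochner_Integration.integrable_diff integrable_hit_mult G)
  have dual: "(\<integral>x. hit UNIV (grid n i) x * hit G (grid n j) x \<partial>m) = ?b (i + j)" for i j
    by (subst hit_duality) (auto simp: G grid_add mass_def)
  \<comment> \<open>Both mixed products have index sum \<open>2 * k + 1\<close> and carry opposite
    signs; only the even indices \<open>2 * k\<close> and \<open>2 * Suc k\<close> are left.\<close>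
  have d_int: "(\<integral>x. ?d k x \<partial>m) = ?b (2 * k) - ?b (2 * Suc k)" for k
    unfolding d_eq by (simp add: integrable_hit_mult G dual mult_2)
  have "(\<integral>\<^sup>+ x. \<integral>\<^sup>+ t. dyadic_sum G n (Some x) t \<partial>lifetime_law (Some x) \<partial>m)
      = (\<integral>\<^sup>+ x. (\<Sum>k. ennreal (?d k x)) \<partial>m)"
    by (simp only: nn_integral_dyadic_sum)
  also have "\<dots> = (\<Sum>k. \<integral>\<^sup>+ x. ennreal (?d k x) \<partial>m)"
    using borel_measurable_integrable[OF int]
    by (intro nn_integral_suminf measurable_compose[OF _ measurable_ennreal])
  also have "\<dots> = (\<Sum>k. ennreal (?b (2 * k) - ?b (2 * Suc k)))"
    by (simp only: nn_integral_eq_integral[OF int AE_I2[OF d_nonneg]] d_int)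
  also have "\<dots> \<le> ennreal (?b 0)"
  proof (rule suminf_le_const)
    fix N
    have nn: "0 \<le> ?b (2 * k) - ?b (2 * Suc k)" for k
    proof -
      have "0 \<le> (\<integral>x. ?d k x \<partial>m)" by (intro integral_nonneg_AE AE_I2 d_nonneg)
      then show ?thesis by (simp only: d_int)
    qed
    have "(\<Sum>k<N. ?b (2 * k) - ?b (2 * Suc k)) = ?b 0 - ?b (2 * N)"
      by (induction N) simp_all
    then show "(\<Sum>k<N. ennreal (?b (2 * k) - ?b (2 * Suc k))) \<le> ennreal (?b 0)"
      using mass_nonneg[of G] by (simp only: sum_ennreal nn) (simp add: ennreal_leI)
  qed simp
  finally show ?thesis
    using G by (simp add: mass_0 m.emeasure_eq_measure)
qed

text \<open>Position of one fixed particle at the death time of the other, both started at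
  \<open>x\<close>; the mass at \<open>None\<close> is the event that it does not outlive the other.
  By symmetry its restriction to \<open>D\<close> is half the law of the survivor, whence the factor
  2 in what follows.\<close>

definition survivor_law :: "'a \<Rightarrow> 'a option measure" where
  "survivor_law x = lifetime_law (Some x) \<bind> (\<lambda>t. law t (Some x))"

lemma measurable_survivor_law: "survivor_law \<in> borel \<rightarrow>\<^sub>M prob_algebra cem_borel"
  unfolding survivor_law_def
proof (rule measurable_bind_prob_space2)
  show "(\<lambda>x. lifetime_law (Some x)) \<in> borel \<rightarrow>\<^sub>M prob_algebra borel"
    by (rule measurable_compose[OF measurable_Some_cem measurable_lifetime_law])
  have "(\<lambda>p. (Some (fst p), snd p)) \<in> borel \<Otimes>\<^sub>M borel \<rightarrow>\<^sub>M (cem_borel \<Otimes>\<^sub>M borel :: ('a option \<times> ennreal) measure)"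
    by (intro measurable_Pair measurable_compose[OF measurable_fst measurable_Some_cem] measurable_snd)
  from measurable_compose[OF this measurable_law_joint]
  show "(\<lambda>(x, t). law t (Some x)) \<in> borel \<Otimes>\<^sub>M borel \<rightarrow>\<^sub>M prob_algebra cem_borel"
    by (simp add: case_prod_beta')
qed

lemma nn_integral_survivor_law:
  assumes "f \<in> borel_measurable cem_borel"
  shows "(\<integral>\<^sup>+ a. f a \<partial>survivor_law x) = (\<integral>\<^sup>+ t. \<integral>\<^sup>+ a. f a \<partial>law t (Some x) \<partial>lifetime_law (Some x))"
  unfolding survivor_law_def
proof (rule nn_integral_bind[OF assms])
  show "(\<lambda>t. law t (Some x)) \<in> lifetime_law (Some x) \<rightarrow>\<^sub>M subprob_algebra cem_borel"
    using measurable_prob_algebraD[OF measurable_law_time]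
    by (simp add: measurable_cong_sets[OF sets_lifetime_law refl])
qed

text \<open>On open sets the bound comes from Fatou, now also in the starting point, and from the
  telescoped sums. Regularity makes it an inequality of measures on \<open>D\<close>, and arbitrary
  \<open>f\<close> follow by monotonicity of the integral in the measure.\<close>

lemma subinvariant:
  assumes f: "f \<in> borel_measurable cem_borel"
  shows "(\<integral>\<^sup>+ x. 2 * (\<integral>\<^sup>+ a. alive f a \<partial>survivor_law x) \<partial>m) \<le> (\<integral>\<^sup>+ x. f (Some x) \<partial>m)"
proof -
  define N where "N = m \<bind> survivor_law"
  \<comment> \<open>The factor 2 counts both particles. The density removes the mass at
    \<open>None\<close> before \<open>the\<close> is applied.\<close>
  define N1 where "N1 = distr (density N (\<lambda>a. 2 * indicator (range Some) a)) borel the"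
  have K: "survivor_law \<in> m \<rightarrow>\<^sub>M subprob_algebra cem_borel"
    using measurable_prob_algebraD[OF measurable_survivor_law]
    by (simp add: measurable_cong_sets[OF sets_m refl])
  have sets_N: "sets N = sets cem_borel"
    unfolding N_def by (rule sets_bind[OF sets_kernel[OF K]]) auto
  have the: "the \<in> cem_borel \<rightarrow>\<^sub>M (borel :: 'a measure)"
    by (rule measurable_cem_borel_option) auto
  have Nint: "(\<integral>\<^sup>+ a. g a \<partial>N) = (\<integral>\<^sup>+ x. \<integral>\<^sup>+ a. g a \<partial>survivor_law x \<partial>m)"
    if "g \<in> borel_measurable cem_borel" for g
    unfolding N_def by (rule nn_integral_bind[OF that K])
  have N1int: "(\<integral>\<^sup>+ x. g x \<partial>N1) = (\<integral>\<^sup>+ x. \<integral>\<^sup>+ a. 2 * indicator (range Some) a * g (the a) \<partial>survivor_law x \<partial>m)"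
    if g: "g \<in> borel_measurable borel" for g
  proof -
    have g': "(\<lambda>a. g (the a)) \<in> borel_measurable cem_borel"
      by (rule measurable_compose[OF the g])
    have "(\<integral>\<^sup>+ x. g x \<partial>N1) = (\<integral>\<^sup>+ a. g (the a) \<partial>density N (\<lambda>a. 2 * indicator (range Some) a))"
      unfolding N1_def using the g
      by (intro nn_integral_distr) (simp_all add: measurable_cong_sets[OF trans[OF sets_density sets_N] refl])
    also have "\<dots> = (\<integral>\<^sup>+ a. 2 * indicator (range Some) a * g (the a) \<partial>N)"
      using g' by (intro nn_integral_density) (auto simp: measurable_cong_sets[OF sets_N refl])
    also have "\<dots> = (\<integral>\<^sup>+ x. \<integral>\<^sup>+ a. 2 * indicator (range Some) a * g (the a) \<partial>survivor_law x \<partial>m)"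
      using g' by (intro Nint borel_measurable_times_ennreal) auto
    finally show ?thesis .
  qed
  have "N1 \<le> m"
  proof (rule measure_le_if_le_on_open[OF finite_m sets_m])
    show "sets N1 = sets borel" by (simp add: N1_def)
    fix G :: "'a set" assume G: "open G"
    have SG: "Some ` G \<in> sets cem_borel" by (rule sets_cem_borel_Some_open[OF G])
    have "emeasure N1 G = (\<integral>\<^sup>+ x. indicator G x \<partial>N1)"
      using G by (simp add: N1_def)
    also have "\<dots> = (\<integral>\<^sup>+ x. \<integral>\<^sup>+ a. 2 * indicator (range Some) a * indicator G (the a) \<partial>survivor_law x \<partial>m)"
      using G by (intro N1int) auto
    also have "\<dots> = (\<integral>\<^sup>+ x. \<integral>\<^sup>+ a. 2 * indicator (Some ` G) a \<partial>survivor_law x \<partial>m)"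
      by (intro nn_integral_cong) (auto simp: indicator_def split: option.splits)
    also have "\<dots> = (\<integral>\<^sup>+ x. \<integral>\<^sup>+ t. 2 * emeasure (law t (Some x)) (Some ` G) \<partial>lifetime_law (Some x) \<partial>m)"
      using SG by (subst nn_integral_survivor_law) (simp_all add: nn_integral_cmult_indicator)
    also have "\<dots> \<le> (\<integral>\<^sup>+ x. liminf (\<lambda>n. \<integral>\<^sup>+ t. dyadic_sum G n (Some x) t \<partial>lifetime_law (Some x)) \<partial>m)"
      by (intro nn_integral_mono branching_le_liminf_dyadic_sum G)
    also have "\<dots> \<le> liminf (\<lambda>n. \<integral>\<^sup>+ x. \<integral>\<^sup>+ t. dyadic_sum G n (Some x) t \<partial>lifetime_law (Some x) \<partial>m)"
    proof (rule nn_integral_liminf)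
      fix n
      have [measurable]: "hit G t \<in> borel_measurable borel" "hit UNIV t \<in> borel_measurable borel" for t
        using G by (auto intro: measurable_hit)
      show "(\<lambda>x. \<integral>\<^sup>+ t. dyadic_sum G n (Some x) t \<partial>lifetime_law (Some x)) \<in> borel_measurable m"
        unfolding nn_integral_dyadic_sum measurable_cong_sets[OF sets_m refl] by measurable
    qed
    also have "\<dots> \<le> liminf (\<lambda>n. emeasure m G)"
      using G by (intro Liminf_mono always_eventually allI nn_integral_dyadic_sum_le) auto
    also have "\<dots> = emeasure m G" by (simp add: Liminf_const)
    finally show "emeasure N1 G \<le> emeasure m G" .
  qed
  have fS: "(\<lambda>x. f (Some x)) \<in> borel_measurable borel"
    by (rule measurable_compose[OF measurable_Some_cem f])
  have "(\<integral>\<^sup>+ x. 2 * (\<integral>\<^sup>+ a. alive f a \<partial>survivor_law x) \<partial>m) = (\<integral>\<^sup>+ x. \<integral>\<^sup>+ a. 2 * alive f a \<partial>survivor_law x \<partial>m)"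
  proof (intro nn_integral_cong nn_integral_cmult[symmetric])
    fix x
    have "sets (survivor_law x) = sets cem_borel"
      using sets_kernel[OF K, of x] by simp
    then show "(\<lambda>a. alive f a) \<in> borel_measurable (survivor_law x)"
      using f by (simp cong: measurable_cong_sets)
  qed
  also have "\<dots> = (\<integral>\<^sup>+ x. \<integral>\<^sup>+ a. 2 * indicator (range Some) a * f (Some (the a)) \<partial>survivor_law x \<partial>m)"
    by (intro nn_integral_cong) (auto simp: indicator_def split: option.splits)
  also have "\<dots> = (\<integral>\<^sup>+ x. f (Some x) \<partial>N1)"
    by (rule N1int[OF fS, symmetric])
  also have "\<dots> \<le> (\<integral>\<^sup>+ x. f (Some x) \<partial>m)"
    using \<open>N1 \<le> m\<close> by (intro nn_integral_mono_measure) (auto simp: N1_def)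
  finally show ?thesis .
qed

end

section \<open>Lifetimes have no atoms\<close>

context self_dual_hunt_process
begin

text \<open>The squared norm of P_s 1 - P_{s+h} 1 is nonnegative, and duality turns its three
  products into values of \<open>mass UNIV\<close> at equally spaced times.\<close>

lemma mass_midpoint:
  assumes "s < \<infinity>" "h < \<infinity>"
  shows "2 * mass UNIV (s + (s + h)) \<le> mass UNIV (s + s) + mass UNIV ((s + h) + (s + h))"
proof -
  have fin: "s + h < \<infinity>" using assms by (simp add: less_top[symmetric])
  have *: "(hit UNIV s x - hit UNIV (s + h) x)\<^sup>2 = hit UNIV s x * hit UNIV s x
      - 2 * (hit UNIV s x * hit UNIV (s + h) x) + hit UNIV (s + h) x * hit UNIV (s + h) x" for x
    by (simp add: power2_eq_square algebra_simps)
  have "0 \<le> (\<integral>x. (hit UNIV s x - hit UNIV (s + h) x)\<^sup>2 \<partial>m)"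
    by (intro integral_nonneg_AE AE_I2) simp
  also have "\<dots> = mass UNIV (s + s) - 2 * mass UNIV (s + (s + h)) + mass UNIV ((s + h) + (s + h))"
    unfolding * using assms fin by (simp add: integrable_hit_mult hit_duality mass_def)
  finally show ?thesis by simp
qed

text \<open>By midpoint convexity the last of \<open>N\<close> equal steps is the smallest one.\<close>

lemma mass_last_step:
  fixes r :: real and N :: nat
  assumes r: "0 < r" and N: "0 < N"
  defines "b \<equiv> \<lambda>j :: nat. mass UNIV (ennreal (real j * r / real N))"
  shows "b (N - 1) - b N \<le> mass UNIV 0 / real N"
proof -
  have "b (Suc i) - b (Suc (Suc i)) \<le> b i - b (Suc i)" for i
  proof -
    \<comment> \<open>Half a grid time, because \<open>mass_midpoint\<close> doubles its arguments:
      the three times become \<open>i\<close>, \<open>i + 1\<close> and \<open>i + 2\<close>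
      multiples of \<open>r / N\<close>.\<close>
    let ?s = "ennreal (real i * r / (2 * real N))" and ?h = "ennreal (r / real N)"
    have "?s + ?s = ennreal (real i * r / real N)"
      using r by (simp flip: ennreal_plus)
    moreover have "?s + (?s + ?h) = ennreal (real (Suc i) * r / real N)"
      using r by (simp add: add_divide_distrib distrib_right add_ac flip: ennreal_plus)
    moreover have "(?s + ?h) + (?s + ?h) = ennreal (real (Suc (Suc i)) * r / real N)"
      using r by (simp add: add_divide_distrib distrib_right add_ac flip: ennreal_plus)
    ultimately show ?thesis
      using mass_midpoint[of ?s ?h] by (simp add: b_def)
  qed
  then have dec: "decseq (\<lambda>j. b j - b (Suc j))"
    by (rule decseq_SucI)
  have "real N * (b (N - 1) - b N) = (\<Sum>j<N. b (N - 1) - b (Suc (N - 1)))"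
    using N by simp
  also have "\<dots> \<le> (\<Sum>j<N. b j - b (Suc j))"
    by (intro sum_mono decseqD[OF dec]) auto
  also have "\<dots> = b 0 - b N"
    by (induction N) simp_all
  also have "\<dots> \<le> mass UNIV 0"
    using mass_nonneg by (simp add: b_def)
  finally show ?thesis using N by (simp add: field_simps)
qed

text \<open>The point \<open>r\<close> lies in the last of \<open>Suc n\<close> equal subintervals,
  whose probability integrates to at most \<open>mass UNIV 0 / Suc n\<close>. The estimate is
  integrated over \<open>m\<close>, hence only almost every start is covered.\<close>

lemma AE_lifetime_law_no_atom:
  assumes r: "0 < r"
  shows "AE x in m. emeasure (lifetime_law (Some x)) {ennreal r} = 0"
proof -
  have meas: "(\<lambda>x. emeasure (lifetime_law (Some x)) {ennreal r}) \<in> borel_measurable borel"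
    using measurable_emeasure_kernel[OF measurable_prob_algebraD[OF measurable_lifetime_law], of "{ennreal r}"]
    by (intro measurable_compose[OF measurable_Some_cem]) auto
  have le: "(\<integral>\<^sup>+ x. emeasure (lifetime_law (Some x)) {ennreal r} \<partial>m) \<le> ennreal (mass UNIV 0 / real (Suc n))" for n
  proof -
    let ?s = "ennreal (real n * r / real (Suc n))" and ?t = "ennreal (real (Suc n) * r / real (Suc n))"
    have t: "?t = ennreal r" by simp
    have st: "?s \<le> ?t" using r by (intro ennreal_leI divide_right_mono mult_right_mono) auto
    have "real n * r / real (Suc n) < r" using r by (simp add: field_simps)
    then have mem: "{ennreal r} \<subseteq> {?s<..?t}"
      unfolding t using r by (simp add: ennreal_less_iff)
    have nn: "0 \<le> hit UNIV ?s x - hit UNIV ?t x" for x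
      using hit_UNIV_antimono[OF st, of x] by simp
    have "(\<integral>\<^sup>+ x. emeasure (lifetime_law (Some x)) {ennreal r} \<partial>m)
        \<le> (\<integral>\<^sup>+ x. emeasure (lifetime_law (Some x)) {?s<..?t} \<partial>m)"
      using mem by (intro nn_integral_mono emeasure_mono) auto
    also have "\<dots> = (\<integral>\<^sup>+ x. ennreal (hit UNIV ?s x - hit UNIV ?t x) \<partial>m)"
      by (simp only: emeasure_lifetime_law_Ioc[OF st])
    also have "\<dots> = ennreal (\<integral>x. hit UNIV ?s x - hit UNIV ?t x \<partial>m)"
      by (intro nn_integral_eq_integral Bochner_Integration.integrable_diff integrable_hit AE_I2 nn) auto
    also have "(\<integral>x. hit UNIV ?s x - hit UNIV ?t x \<partial>m) = mass UNIV ?s - mass UNIV ?t"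
      unfolding mass_def by (intro Bochner_Integration.integral_diff integrable_hit) auto
    also have "ennreal \<dots> \<le> ennreal (mass UNIV 0 / real (Suc n))"
      using mass_last_step[OF r, of "Suc n"] by (intro ennreal_leI) simp
    finally show ?thesis .
  qed
  have "(\<lambda>n. mass UNIV 0 / real (Suc n)) \<longlonglongrightarrow> 0"
    by (rule LIMSEQ_Suc[OF lim_const_over_n])
  from tendsto_ennrealI[OF this] le
  have "(\<integral>\<^sup>+ x. emeasure (lifetime_law (Some x)) {ennreal r} \<partial>m) \<le> 0"
    by (intro LIMSEQ_le_const) auto
  then show ?thesis
    using meas by (subst (asm) le_zero_eq, subst (asm) nn_integral_0_iff_AE)
      (simp_all add: measurable_cong_sets[OF sets_m refl])
qed

end

section \<open>From almost every to every starting point\<close>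

locale absolutely_continuous_hunt_process = self_dual_hunt_process M F P X m
  for M :: "'w measure" and F
    and P :: "'a::{metric_space, second_countable_topology} option \<Rightarrow> 'w measure" and X and m +
  assumes abs_cont: "\<And>t z. 0 < t \<Longrightarrow> t < \<infinity> \<Longrightarrow> absolutely_continuous m (one_dim_law P X t z)"
begin

lemma law_null_sets:
  assumes N: "N \<in> null_sets m" and t: "0 < t" "t < \<infinity>"
  shows "emeasure (law t (Some x)) (Some ` N) = 0"
proof -
  have Nb: "N \<in> sets borel" using N by auto
  let ?R = "restrict_space (P (Some x)) {\<omega>. X t \<omega> \<noteq> None}"
  have the: "the \<in> cem_borel \<rightarrow>\<^sub>M (borel :: 'a measure)"
    by (rule measurable_cem_borel_option) auto
  have "(\<lambda>\<omega>. the (X t \<omega>)) \<in> P (Some x) \<rightarrow>\<^sub>M borel"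
    using measurable_compose[OF measurable_X the, of t] by (simp add: measurable_cong_sets[OF sets_P refl])
  then have meas: "(\<lambda>\<omega>. the (X t \<omega>)) \<in> ?R \<rightarrow>\<^sub>M borel"
    by (rule measurable_restrict_space1)
  have "{\<omega>. X t \<omega> \<noteq> None} \<inter> space (P (Some x)) = X t -` range Some \<inter> space M"
    by (auto simp: notin_range_Some)
  then have alive: "{\<omega>. X t \<omega> \<noteq> None} \<inter> space (P (Some x)) \<in> sets (P (Some x))"
    using measurable_sets[OF measurable_X range_Some_cem, of t] by (simp add: sets_P)
  have "N \<in> null_sets (one_dim_law P X t x)"
    using abs_cont[OF t, of x] N by (auto simp: absolutely_continuous_def)
  then have "0 = emeasure (one_dim_law P X t x) N" by auto
  also have "\<dots> = emeasure ?R ((\<lambda>\<omega>. the (X t \<omega>)) -` N \<inter> space ?R)"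
    unfolding one_dim_law_def using meas Nb by (rule emeasure_distr)
  also have "\<dots> = emeasure (P (Some x)) ((\<lambda>\<omega>. the (X t \<omega>)) -` N \<inter> space ?R)"
    using alive by (intro emeasure_restrict_space) (auto simp: space_restrict_space)
  also have "(\<lambda>\<omega>. the (X t \<omega>)) -` N \<inter> space ?R = {\<omega> \<in> space M. X t \<omega> \<in> Some ` N}"
    by (force simp: space_restrict_space)
  finally show ?thesis
    using Nb by (simp add: emeasure_law sets_cem_borel_Some)
qed

text \<open>How absolute continuity is used: what holds for almost every point holds at the position
  at any fixed positive finite time, from every start. The cemetery, which \<open>m\<close> does not
  see, is exempted.\<close>

lemma AE_law:
  assumes ae: "AE y in m. R y" and t: "0 < t" "t < \<infinity>"
  shows "AE a in law t (Some x). \<forall>y. a = Some y \<longrightarrow> R y"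
proof -
  from ae obtain N where N: "N \<in> null_sets m" "{y \<in> space m. \<not> R y} \<subseteq> N"
    by (auto elim!: AE_E simp: null_sets_def)
  have "Some ` N \<in> sets cem_borel"
    using N(1) by (intro sets_cem_borel_Some) auto
  then have "Some ` N \<in> null_sets (law t (Some x))"
    using law_null_sets[OF N(1) t] by auto
  then show ?thesis
    by (rule AE_I') (use N(2) in auto)
qed

text \<open>The Markov property for the residual lifetime after time \<open>s\<close>. Tails are
  compared because a particle already dead has residual lifetime 0 and never enters
  \<open>{q<..}\<close>.\<close>

lemma emeasure_bind_lifetime_law:
  assumes q: "q < \<infinity>"
  shows "emeasure (law s z \<bind> lifetime_law) {q<..} = emeasure (lifetime_law z) {s + q<..}"
proof -
  have sp: "space (law s z) \<noteq> {}" by simp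
  have meas: "(\<lambda>a. measure (law q a) (range Some)) \<in> borel_measurable cem_borel"
    using kernel_measurable[OF range_Some_cem, of q] by (simp add: measure_law)
  have "emeasure (law s z \<bind> lifetime_law) {q<..} = (\<integral>\<^sup>+ a. emeasure (lifetime_law a) {q<..} \<partial>law s z)"
    using measurable_prob_algebraD[OF measurable_lifetime_law]
    by (intro emeasure_bind[where N = borel] sp) (simp_all add: measurable_cong_sets[OF sets_law refl])
  also have "\<dots> = (\<integral>\<^sup>+ a. ennreal (measure (law q a) (range Some)) \<partial>law s z)"
    unfolding emeasure_lifetime_law_greaterThan
    by (intro nn_integral_cong finite_measure.emeasure_eq_measure prob_space.finite_measure prob_space_law)
  also have "\<dots> = (\<integral>\<^sup>+ \<omega>. ennreal (measure (law q (X s \<omega>)) (range Some)) \<partial>P z)"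
    unfolding law_eq[of s] using meas
    by (intro nn_integral_distr) (auto simp: measurable_cong_sets[OF sets_P refl])
  also have "\<dots> = ennreal (\<integral>\<omega>. measure (law q (X s \<omega>)) (range Some) \<partial>P z)"
  proof (intro nn_integral_eq_integral AE_I2)
    interpret prob_space "P z" by (rule prob_space_P)
    show "integrable (P z) (\<lambda>\<omega>. measure (law q (X s \<omega>)) (range Some))"
      using measurable_compose[OF measurable_X meas, of s]
      by (intro integrable_const_bound[of _ 1])
         (auto simp: prob_space.prob_le_1[OF prob_space_law] measurable_cong_sets[OF sets_P refl])
  qed simp
  also have "\<dots> = emeasure (lifetime_law z) {s + q<..}"
    unfolding emeasure_lifetime_law_greaterThan
    by (simp add: markov[OF q, symmetric]
      finite_measure.emeasure_eq_measure[OF prob_space.finite_measure[OF prob_space_law]])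
  finally show ?thesis .
qed

text \<open>Wait for half of \<open>t\<close>: the position on \<open>D\<close> is then absolutely
  continuous, and from almost every point the residual lifetime has no atom at the remaining
  half.\<close>

lemma lifetime_law_no_atom:
  assumes t: "t < \<infinity>"
  shows "emeasure (lifetime_law (Some x)) {t} = 0"
proof (cases "t = 0")
  case True
  have "{s \<in> space (lifetime_law (Some x)). \<not> 0 < s} = {0}"
    by (auto simp: lifetime_law_def)
  then show ?thesis
    using AE_lifetime_law_pos[of x] True by (simp add: AE_iff_measurable[OF _ refl])
next
  case False
  then obtain r where r: "t = ennreal r" "0 < r"
    using t by (cases t) auto
  define q where "q = ennreal (r / 2)"
  have q: "0 < q" "q < \<infinity>" and tq: "q + q = t"
    using r by (auto simp: q_def simp flip: ennreal_plus)
  define L where "L = law q (Some x) \<bind> lifetime_law"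
  have K: "lifetime_law \<in> law q (Some x) \<rightarrow>\<^sub>M subprob_algebra borel"
    using measurable_prob_algebraD[OF measurable_lifetime_law] by (simp add: measurable_cong_sets[OF sets_law refl])
  have sets_L [simp]: "sets L = sets borel"
    unfolding L_def by (rule sets_bind[OF sets_kernel[OF K]]) auto
  interpret L: prob_space L
    unfolding L_def by (rule prob_space_bind'[of _ cem_borel _ borel])
      (auto simp: space_prob_algebra prob_space_law)
  interpret l: prob_space "lifetime_law (Some x)" by (rule prob_space_lifetime_law)
  have L_atom: "emeasure L {q} = 0"
  proof -
    have "emeasure L {q} = (\<integral>\<^sup>+ a. emeasure (lifetime_law a) {q} \<partial>law q (Some x))"
      unfolding L_def using K by (intro emeasure_bind) auto
    also have "\<dots> = (\<integral>\<^sup>+ a. 0 \<partial>law q (Some x))"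
    proof (rule nn_integral_cong_AE)
      have "AE y in m. emeasure (lifetime_law (Some y)) {q} = 0"
        unfolding q_def using r by (intro AE_lifetime_law_no_atom) simp
      from AE_law[OF this q]
      show "AE a in law q (Some x). emeasure (lifetime_law a) {q} = 0"
      proof eventually_elim
        case (elim a)
        show ?case
        proof (cases a)
          case None
          have "emeasure (lifetime_law None) {q} \<le> emeasure (lifetime_law None) {0<..}"
            using q by (intro emeasure_mono) auto
          also have "\<dots> = 0"
            unfolding emeasure_lifetime_law_greaterThan law_0 by simp
          finally show ?thesis using None by simp
        qed (use elim in auto)
      qed
    qed
    finally show ?thesis by simp
  qed
  \<comment> \<open>The residual law is tied to the lifetime law through tails, that is through
    half-open intervals, so the atom is enclosed in intervals shrinking to \<open>q\<close> from the
    left.\<close>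
  let ?p = "\<lambda>n. grid n (grid_index n q - 1)"
  have le: "emeasure (lifetime_law (Some x)) {t} \<le> emeasure L {?p n<..q}" for n
  proof -
    have pq: "?p n < q" by (rule grid_pred_less[OF q])
    have "{t} \<subseteq> {q + ?p n<..q + q}"
      using pq q tq by (auto simp: ennreal_add_left_cancel_less)
    then have "emeasure (lifetime_law (Some x)) {t} \<le> emeasure (lifetime_law (Some x)) {q + ?p n<..q + q}"
      by (intro emeasure_mono) auto
    also have "{q + ?p n<..q + q} = {q + ?p n<..} - {q + q<..}" by auto
    also have "emeasure (lifetime_law (Some x)) \<dots>
        = emeasure (lifetime_law (Some x)) {q + ?p n<..} - emeasure (lifetime_law (Some x)) {q + q<..}"
      using pq by (intro emeasure_Diff) (auto intro: order_le_less_trans add_left_mono)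
    also have "\<dots> = emeasure L {?p n<..} - emeasure L {q<..}"
      unfolding L_def using q by (simp only: emeasure_bind_lifetime_law grid_less_top)
    also have "\<dots> = emeasure L ({?p n<..} - {q<..})"
      using pq by (intro emeasure_Diff[symmetric]) auto
    also have "{?p n<..} - {q<..} = {?p n<..q}" by auto
    finally show ?thesis .
  qed
  have "(\<lambda>n. emeasure L {?p n<..q}) \<longlonglongrightarrow> emeasure L (\<Inter>n. {?p n<..q})"
  proof (rule Lim_emeasure_decseq)
    show "decseq (\<lambda>n. {?p n<..q})"
      unfolding decseq_def
    proof (intro allI impI)
      fix i j :: nat assume "i \<le> j"
      then have "?p i \<le> ?p j" by (rule incseqD[OF grid_pred_incseq[OF q]])
      then show "{?p j<..q} \<subseteq> {?p i<..q}" by auto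
    qed
  qed auto
  also have "(\<Inter>n. {?p n<..q}) = {q}"
  proof (intro equalityI subsetI)
    fix s assume s: "s \<in> (\<Inter>n. {?p n<..q})"
    then have "q \<le> s"
      by (intro LIMSEQ_le_const2[OF grid_index_tendsto(2)[OF q]]) (auto intro: less_imp_le)
    with s show "s \<in> {q}" by auto
  qed (use grid_pred_less[OF q] in auto)
  finally have "(\<lambda>n. emeasure L {?p n<..q}) \<longlonglongrightarrow> 0"
    unfolding L_atom .
  then have "emeasure (lifetime_law (Some x)) {t} \<le> 0"
    by (rule LIMSEQ_le_const) (use le in auto)
  then show ?thesis by simp
qed

text \<open>Given the first path, a finite tie asks the independent second lifetime to hit one fixed
  value.\<close>

lemma AE_no_tie:
  "AE p in Q (Some x) \<Otimes>\<^sub>M Q (Some y). lifetime (fst p) = lifetime (snd p) \<longrightarrow> lifetime (fst p) = \<infinity>"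
proof -
  interpret x: prob_space "Q (Some x)" by (rule prob_space_Q)
  interpret y: prob_space "Q (Some y)" by (rule prob_space_Q)
  interpret pair_sigma_finite "Q (Some x)" "Q (Some y)" ..
  show ?thesis
  proof (rule AE_pair_measure)
    have [measurable]: "(\<lambda>p. lifetime (fst p)) \<in> borel_measurable (Q (Some x) \<Otimes>\<^sub>M Q (Some y))"
      "(\<lambda>p. lifetime (snd p)) \<in> borel_measurable (Q (Some x) \<Otimes>\<^sub>M Q (Some y))"
      by (rule measurable_compose[OF _ measurable_lifetime], simp)+
    show "{p \<in> space (Q (Some x) \<Otimes>\<^sub>M Q (Some y)).
        lifetime (fst p) = lifetime (snd p) \<longrightarrow> lifetime (fst p) = \<infinity>} \<in> sets (Q (Some x) \<Otimes>\<^sub>M Q (Some y))"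
      by measurable
    show "AE u in Q (Some x). AE v in Q (Some y).
        lifetime (fst (u, v)) = lifetime (snd (u, v)) \<longrightarrow> lifetime (fst (u, v)) = \<infinity>"
    proof (rule AE_I2)
      fix u assume "u \<in> space (Q (Some x))"
      show "AE v in Q (Some y). lifetime (fst (u, v)) = lifetime (snd (u, v)) \<longrightarrow> lifetime (fst (u, v)) = \<infinity>"
      proof (cases "lifetime u = \<infinity>")
        case False
        then have "lifetime u < \<infinity>" by (simp add: less_top[symmetric])
        from lifetime_law_no_atom[OF this, of y]
        have "{lifetime u} \<in> null_sets (lifetime_law (Some y))" by auto
        then have "AE t in lifetime_law (Some y). t \<notin> {lifetime u}" by (rule AE_not_in)
        then have "AE v in Q (Some y). lifetime v \<notin> {lifetime u}"
          unfolding lifetime_law_def by (subst (asm) AE_distr_iff) auto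
        then show ?thesis by eventually_elim auto
      qed simp
    qed
  qed
qed

end

section \<open>Vanishing of the discounted survival functional\<close>

lemma measurable_branch_integrand:
  fixes f :: "'b::metric_space option \<Rightarrow> ennreal"
  assumes "f \<in> borel_measurable cem_borel"
  shows "(\<lambda>p. discount (stage_length (fst p) (snd p)) * alive f (survivor (fst p) (snd p)))
    \<in> borel_measurable (path_space \<Otimes>\<^sub>M path_space)"
proof -
  have 1: "(\<lambda>p. discount (stage_length (fst p) (snd p))) \<in> borel_measurable (path_space \<Otimes>\<^sub>M path_space)"
    using measurable_compose[OF measurable_stage_length measurable_discount] by (simp add: case_prod_beta')
  have "alive f \<in> borel_measurable cem_borel"
    using assms by measurable
  from measurable_compose[OF measurable_survivor this]
  have 2: "(\<lambda>p. alive f (survivor (fst p) (snd p))) \<in> borel_measurable (path_space \<Otimes>\<^sub>M path_space)"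
    by (simp add: case_prod_beta')
  show ?thesis by (rule borel_measurable_times_ennreal[OF 1 2])
qed

context hunt_process
begin

text \<open>\<open>iterated_discount n (Some x)\<close> is the expectation of \<open>exp (- \<tau> n)\<close> on the event that the first
  \<open>n\<close> stages of a system started at \<open>(x, x)\<close> end with a survivor.\<close>

definition iterated_discount :: "nat \<Rightarrow> 'a option \<Rightarrow> ennreal" where
  "iterated_discount n = ((\<lambda>f z. branch_op f z z) ^^ n) (\<lambda>_. 1)"

lemma iterated_discount_0 [simp]: "iterated_discount 0 z = 1"
  and iterated_discount_Suc: "iterated_discount (Suc n) z = branch_op (iterated_discount n) z z"
  by (simp_all add: iterated_discount_def)

lemma measurable_iterated_discount [measurable]: "iterated_discount n \<in> borel_measurable cem_borel"
proof (induction n)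
  case (Suc n)
  then show ?case
    using measurable_branch_op_diag by (simp add: iterated_discount_Suc[abs_def])
qed (simp add: iterated_discount_def)

lemma branch_op_mono: "(\<And>a. f a \<le> g a) \<Longrightarrow> branch_op f z z' \<le> branch_op g z z'"
  unfolding branch_op_def by (intro nn_integral_mono mult_left_mono) auto

lemma branch_op_le_1:
  assumes "\<And>a. f a \<le> 1" shows "branch_op f z z' \<le> 1"
proof -
  interpret z: prob_space "Q z" by (rule prob_space_Q)
  interpret z': prob_space "Q z'" by (rule prob_space_Q)
  interpret pair_prob_space "Q z" "Q z'" ..
  have "branch_op f z z' \<le> (\<integral>\<^sup>+ p. 1 \<partial>(Q z \<Otimes>\<^sub>M Q z'))"
    unfolding branch_op_def
  proof (rule nn_integral_mono)
    fix p
    have "discount (stage_length (fst p) (snd p)) * alive f (survivor (fst p) (snd p)) \<le> 1 * (1 * 1)"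
      by (intro mult_mono discount_le_1 assms) (auto simp: indicator_def)
    then show "discount (stage_length (fst p) (snd p)) * alive f (survivor (fst p) (snd p)) \<le> 1"
      by simp
  qed
  also have "\<dots> = 1" by (simp add: emeasure_space_1)
  finally show ?thesis .
qed

lemma iterated_discount_le_1: "iterated_discount n z \<le> 1"
  by (induction n arbitrary: z) (auto simp: iterated_discount_Suc intro: branch_op_le_1)

lemma iterated_discount_Suc_le: "iterated_discount (Suc n) z \<le> iterated_discount n z"
  by (induction n arbitrary: z)
     (auto simp: iterated_discount_Suc[of "Suc _"] iterated_discount_Suc[of 0] intro: branch_op_mono branch_op_le_1,
      auto simp: iterated_discount_Suc intro: branch_op_mono)

lemma decseq_iterated_discount: "decseq (\<lambda>n. iterated_discount n z)"
  by (rule decseq_SucI) (rule iterated_discount_Suc_le)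

text \<open>The \<phi> of the overview, on the event that every stage ends with a survivor. As a
  limit of iterated kernels it is defined at every point without realising a system started
  there.\<close>

definition limit_discount :: "'a option \<Rightarrow> ennreal" where
  "limit_discount z = (INF n. iterated_discount n z)"

lemma measurable_limit_discount [measurable]: "limit_discount \<in> borel_measurable cem_borel"
  unfolding limit_discount_def[abs_def] by measurable

lemma iterated_discount_tendsto: "(\<lambda>n. iterated_discount n z) \<longlonglongrightarrow> limit_discount z"
  unfolding limit_discount_def by (rule LIMSEQ_INF[OF decseq_iterated_discount])

lemma limit_discount_le_1: "limit_discount z \<le> 1"
  unfolding limit_discount_def using INF_lower[of 0 UNIV "\<lambda>n. iterated_discount n z"] by simp

lemma branch_op_iterated_discount_tendsto:
  "(\<lambda>n. branch_op (iterated_discount n) z z') \<longlonglongrightarrow> branch_op limit_discount z z'"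
  unfolding branch_op_def
proof (rule nn_integral_dominated_convergence[where w = "\<lambda>_. 1"])
  interpret z: prob_space "Q z" by (rule prob_space_Q)
  interpret z': prob_space "Q z'" by (rule prob_space_Q)
  interpret pair_prob_space "Q z" "Q z'" ..
  have sets_QQ: "sets (Q z \<Otimes>\<^sub>M Q z') = sets (path_space \<Otimes>\<^sub>M path_space)"
    by (intro sets_pair_measure_cong) simp_all
  show "(\<integral>\<^sup>+ p. 1 \<partial>(Q z \<Otimes>\<^sub>M Q z')) < \<infinity>" by (simp add: emeasure_space_1)
  have "(\<lambda>p. discount (stage_length (fst p) (snd p)) * alive f (survivor (fst p) (snd p)))
      \<in> borel_measurable (Q z \<Otimes>\<^sub>M Q z')" if "f \<in> borel_measurable cem_borel" for f :: "'a option \<Rightarrow> ennreal"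
    unfolding measurable_cong_sets[OF sets_QQ refl] by (rule measurable_branch_integrand[OF that])
  then show "(\<lambda>p. discount (stage_length (fst p) (snd p)) * alive limit_discount (survivor (fst p) (snd p)))
      \<in> borel_measurable (Q z \<Otimes>\<^sub>M Q z')"
    and "(\<lambda>p. discount (stage_length (fst p) (snd p)) * alive (iterated_discount n) (survivor (fst p) (snd p)))
      \<in> borel_measurable (Q z \<Otimes>\<^sub>M Q z')" for n
    using measurable_limit_discount measurable_iterated_discount by auto
  show "AE p in Q z \<Otimes>\<^sub>M Q z'.
      discount (stage_length (fst p) (snd p)) * alive (iterated_discount n) (survivor (fst p) (snd p)) \<le> 1" for n
  proof (rule AE_I2)
    fix p
    have "discount (stage_length (fst p) (snd p)) * alive (iterated_discount n) (survivor (fst p) (snd p)) \<le> 1 * (1 * 1)"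
      by (intro mult_mono discount_le_1 iterated_discount_le_1) (auto simp: indicator_def)
    then show "discount (stage_length (fst p) (snd p)) * alive (iterated_discount n) (survivor (fst p) (snd p)) \<le> 1"
      by simp
  qed
  show "AE p in Q z \<Otimes>\<^sub>M Q z'.
      (\<lambda>n. discount (stage_length (fst p) (snd p)) * alive (iterated_discount n) (survivor (fst p) (snd p)))
      \<longlonglongrightarrow> discount (stage_length (fst p) (snd p)) * alive limit_discount (survivor (fst p) (snd p))"
    using le_less_trans[OF discount_le_1 ennreal_one_less_top]
    by (intro AE_I2 ennreal_tendsto_cmult iterated_discount_tendsto) (auto simp: indicator_def)
qed simp

lemma limit_discount_fixpoint: "limit_discount z = branch_op limit_discount z z"
proof (rule LIMSEQ_unique)
  show "(\<lambda>n. iterated_discount (Suc n) z) \<longlonglongrightarrow> limit_discount z"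
    by (rule LIMSEQ_Suc[OF iterated_discount_tendsto])
  show "(\<lambda>n. iterated_discount (Suc n) z) \<longlonglongrightarrow> branch_op limit_discount z z"
    unfolding iterated_discount_Suc by (rule branch_op_iterated_discount_tendsto)
qed

end

context self_dual_hunt_process
begin

text \<open>The undiscounted operator contracts the \<open>m\<close>-integral, so the fixed point equation of
  \<open>limit_discount\<close> can only hold if discounting loses nothing; but every stage has positive
  length.\<close>

lemma AE_limit_discount: "AE x in m. limit_discount (Some x) = 0"
proof -
  let ?\<phi> = limit_discount
  define p where "p x t = (\<integral>\<^sup>+ a. alive ?\<phi> a \<partial>law t (Some x))" for x t
  define g where "g x = 2 * (\<integral>\<^sup>+ t. discount t * p x t \<partial>lifetime_law (Some x))" for x
  define k where "k x = 2 * (\<integral>\<^sup>+ t. p x t \<partial>lifetime_law (Some x))" for x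
  have alive_meas: "alive ?\<phi> \<in> borel_measurable cem_borel" by measurable
  have p_meas: "p x \<in> borel_measurable (lifetime_law (Some x))" for x
  proof -
    have "(\<lambda>t. p x t) \<in> borel_measurable borel"
      unfolding p_def using alive_meas by (intro nn_integral_law_measurable) auto
    then show ?thesis by (simp add: measurable_cong_sets[OF sets_lifetime_law refl])
  qed
  have disc_meas: "discount \<in> borel_measurable (lifetime_law (Some x))" for x
    by (simp add: measurable_cong_sets[OF sets_lifetime_law refl])
  have dp_meas: "(\<lambda>t. discount t * p x t) \<in> borel_measurable (lifetime_law (Some x))" for x
    by (rule borel_measurable_times_ennreal[OF disc_meas p_meas])
  have p_le: "p x t \<le> 1" for x t
  proof -
    have "p x t \<le> (\<integral>\<^sup>+ a. 1 \<partial>law t (Some x))"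
      unfolding p_def
    proof (rule nn_integral_mono)
      fix a show "alive ?\<phi> a \<le> 1"
        using limit_discount_le_1[of a] by (auto simp: indicator_def)
    qed
    then show ?thesis by (simp add: prob_space.emeasure_space_1[OF prob_space_law, unfolded space_law])
  qed
  have dp_le: "discount t * p x t \<le> p x t" for x t
    using mult_right_mono[OF discount_le_1[of t], of "p x t"] by simp
  have g_eq: "?\<phi> (Some x) = g x" for x
    unfolding g_def p_def using limit_discount_fixpoint[of "Some x"]
      branch_op_eq[OF measurable_limit_discount, of "Some x" "Some x"] by (simp add: mult_2)
  have gk: "g x \<le> k x" for x
    unfolding g_def k_def by (intro mult_left_mono nn_integral_mono dp_le) simp
  have k_eq: "k x = 2 * (\<integral>\<^sup>+ a. alive ?\<phi> a \<partial>survivor_law x)" for x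
    unfolding k_def p_def by (simp only: nn_integral_survivor_law[OF alive_meas])
  have k_meas: "k \<in> borel_measurable m"
  proof -
    have "(\<lambda>x. \<integral>\<^sup>+ a. alive ?\<phi> a \<partial>survivor_law x) \<in> borel_measurable borel"
      using nn_integral_measurable_subprob_algebra[OF alive_meas]
        measurable_compose[OF measurable_prob_algebraD[OF measurable_survivor_law]] by blast
    then show ?thesis
      unfolding k_eq[abs_def] measurable_cong_sets[OF sets_m refl] by measurable
  qed
  have g_meas: "g \<in> borel_measurable m"
    unfolding g_eq[abs_def, symmetric] measurable_cong_sets[OF sets_m refl]
    by (rule measurable_compose[OF measurable_Some_cem measurable_limit_discount])
  have "(\<integral>\<^sup>+ x. g x \<partial>m) \<le> (\<integral>\<^sup>+ x. 1 \<partial>m)"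
    unfolding g_eq[symmetric] by (intro nn_integral_mono limit_discount_le_1)
  also have "\<dots> < \<infinity>" by (simp add: m.emeasure_eq_measure)
  finally have fin: "(\<integral>\<^sup>+ x. g x \<partial>m) \<noteq> \<infinity>" by simp
  have "(\<integral>\<^sup>+ x. k x - g x \<partial>m) = (\<integral>\<^sup>+ x. k x \<partial>m) - (\<integral>\<^sup>+ x. g x \<partial>m)"
    by (rule nn_integral_diff[OF k_meas g_meas fin AE_I2[OF gk]])
  \<comment> \<open>Subinvariance bounds the integral of \<open>k\<close> by that of \<phi>, and
    \<phi> equals \<open>g\<close> by the fixed point equation; together with
    \<open>g \<le> k\<close> the two integrals agree.\<close>
  also have "\<dots> = 0"
  proof (rule diff_eq_0_ennreal)
    show le: "(\<integral>\<^sup>+ x. k x \<partial>m) \<le> (\<integral>\<^sup>+ x. g x \<partial>m)"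
      using subinvariant[OF measurable_limit_discount] by (simp add: k_eq g_eq)
    show "(\<integral>\<^sup>+ x. k x \<partial>m) < top"
      using le_less_trans[OF le] fin by (simp add: less_top)
  qed
  finally have "AE x in m. k x - g x = 0"
    using k_meas g_meas by (subst (asm) nn_integral_0_iff_AE) auto
  then show ?thesis
  proof eventually_elim
    case (elim x)
    have g_le: "g x \<le> 1" using limit_discount_le_1[of "Some x"] by (simp add: g_eq)
    then have g_fin: "g x < \<infinity>" by (simp add: le_less_trans[OF _ ennreal_one_less_top])
    have dfin: "(\<integral>\<^sup>+ t. discount t * p x t \<partial>lifetime_law (Some x)) \<noteq> \<infinity>"
      using g_fin unfolding g_def by (auto simp: ennreal_mult_less_top)
    have "k x \<le> g x" using elim g_fin by (simp add: diff_eq_0_iff_ennreal)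
    then have "2 * (\<integral>\<^sup>+ t. p x t \<partial>lifetime_law (Some x))
        \<le> 2 * (\<integral>\<^sup>+ t. discount t * p x t \<partial>lifetime_law (Some x))"
      unfolding k_def g_def .
    then have le: "(\<integral>\<^sup>+ t. p x t \<partial>lifetime_law (Some x)) \<le> (\<integral>\<^sup>+ t. discount t * p x t \<partial>lifetime_law (Some x))"
      by (subst (asm) ennreal_mult_le_mult_iff) auto
    have "(\<integral>\<^sup>+ t. p x t \<partial>lifetime_law (Some x)) < top"
      using le_less_trans[OF le] dfin by (simp add: less_top)
    then have "(\<integral>\<^sup>+ t. p x t - discount t * p x t \<partial>lifetime_law (Some x)) = 0"
      using nn_integral_diff[OF p_meas dp_meas dfin AE_I2[OF dp_le]]
      by (simp add: diff_eq_0_ennreal[OF _ le])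
    \<comment> \<open>The same argument one level down, in the time variable: discounting removes
      nothing although \<open>discount t < 1\<close> for positive \<open>t\<close>, so
      \<open>p x t\<close> has to vanish.\<close>
    then have "AE t in lifetime_law (Some x). p x t - discount t * p x t = 0"
      using p_meas dp_meas by (subst (asm) nn_integral_0_iff_AE) auto
    then have "AE t in lifetime_law (Some x). p x t = 0"
      using AE_lifetime_law_pos[of x]
    proof eventually_elim
      case (elim t)
      have fin: "p x t < \<infinity>" using p_le[of x t] by (simp add: le_less_trans[OF _ ennreal_one_less_top])
      have le: "p x t \<le> discount t * p x t"
        using elim(1) fin by (simp add: diff_eq_0_iff_ennreal)
      show ?case
      proof (rule ccontr)
        assume "p x t \<noteq> 0"
        then have "discount t * p x t < 1 * p x t"
          using discount_less_1[OF elim(2)] fin by (intro ennreal_mult_strict_right_mono) (auto simp: zero_less_iff_neq_zero)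
        with le show False by simp
      qed
    qed
    then have "k x = (2 * (\<integral>\<^sup>+ t. 0 \<partial>lifetime_law (Some x)))"
      unfolding k_def by (intro arg_cong2[where f = "(*)"] refl nn_integral_cong_AE)
    then show ?case using gk[of x] by (simp add: g_eq)
  qed
qed

end

context absolutely_continuous_hunt_process
begin

text \<open>The two starts may differ here, so the fixed point equation says nothing directly. At
  the positive, finite death time of one particle the other has an absolutely continuous law, which
  ignores the null set where the fixed point is nonzero; an infinite time is removed by the
  discount.\<close>

lemma branch_op_limit_discount: "branch_op limit_discount (Some x) (Some y) = 0"
proof -
  have *: "(\<integral>\<^sup>+ t. discount t * (\<integral>\<^sup>+ a. alive limit_discount a \<partial>law t (Some x)) \<partial>lifetime_law (Some y)) = 0" for x y
  proof -
    have "AE t in lifetime_law (Some y). discount t * (\<integral>\<^sup>+ a. alive limit_discount a \<partial>law t (Some x)) = 0"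
      using AE_lifetime_law_pos[of y]
    proof eventually_elim
      case (elim t)
      show ?case
      proof (cases "t = \<infinity>")
        case False
        then have t: "0 < t" "t < \<infinity>" using elim by (simp_all add: less_top[symmetric])
        have "AE a in law t (Some x). alive limit_discount a = 0"
          using AE_law[OF AE_limit_discount t, of x] by eventually_elim (auto simp: indicator_def)
        then have "(\<integral>\<^sup>+ a. alive limit_discount a \<partial>law t (Some x)) = (\<integral>\<^sup>+ a. 0 \<partial>law t (Some x))"
          by (rule nn_integral_cong_AE)
        then show ?thesis by simp
      qed (simp add: discount_def)
    qed
    then have "(\<integral>\<^sup>+ t. discount t * (\<integral>\<^sup>+ a. alive limit_discount a \<partial>law t (Some x)) \<partial>lifetime_law (Some y))
        = (\<integral>\<^sup>+ t. 0 \<partial>lifetime_law (Some y))"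
      by (rule nn_integral_cong_AE)
    then show ?thesis by simp
  qed
  show ?thesis unfolding branch_op_eq[OF measurable_limit_discount] * by simp
qed

end

section \<open>The branching times\<close>

text \<open>\<open>real_cond_exp\<close> passes through \<open>enn2real\<close>, which sends
  \<infinity> to 0; the bound by 1 keeps the nonnegative version finite. This connects the restart
  law, stated with \<open>real_cond_exp\<close>, to nonnegative integrals.\<close>

lemma (in sigma_finite_subalgebra) AE_real_cond_exp_eq_nn_cond_exp:
  assumes f: "f \<in> borel_measurable M" "\<And>x. 0 \<le> f x" "\<And>x. f x \<le> 1"
  shows "AE x in M. ennreal (real_cond_exp M F f x) = nn_cond_exp M F (\<lambda>x. ennreal (f x)) x"
proof -
  have f': "(\<lambda>x. ennreal (f x)) \<in> borel_measurable M"
    by (rule measurable_compose[OF f(1) measurable_ennreal])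
  have "(\<lambda>x. ennreal (- f x)) = (\<lambda>_. 0)" using f(2) by (simp add: ennreal_neg)
  moreover have "AE x in M. (0 :: ennreal) = nn_cond_exp M F (\<lambda>_. 0) x"
    by (rule nn_cond_exp_F_meas) simp
  moreover have "AE x in M. (1 :: ennreal) = nn_cond_exp M F (\<lambda>_. 1) x"
    by (rule nn_cond_exp_F_meas) simp
  moreover have "AE x in M. nn_cond_exp M F (\<lambda>x. ennreal (f x)) x \<le> nn_cond_exp M F (\<lambda>_. 1) x"
    using f f' by (intro nn_cond_exp_mono) auto
  ultimately show ?thesis
    unfolding real_cond_exp_def
    by (auto elim!: eventually_elim2 simp: ennreal_enn2real_if top_unique)
qed

lemma survivor_eq_None_iff:
  assumes "u \<in> cadlag_paths" "v \<in> cadlag_paths"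
  shows "survivor u v = None \<longleftrightarrow> lifetime u = lifetime v"
  using less_lifetime_iff[OF assms(1), of "lifetime v"] less_lifetime_iff[OF assms(2), of "lifetime u"]
  by (cases "lifetime u" "lifetime v" rule: linorder_cases) (auto simp: survivor_def)

section \<open>The past of the realised system and the restart\<close>

locale hunt_fleming_viot = absolutely_continuous_hunt_process M F P X m +
    fv: fleming_viot_system S "path_law P X" U V Xbar Ybar \<tau> x y
  for M :: "'w measure" and F
    and P :: "'a::{metric_space, second_countable_topology} option \<Rightarrow> 'w measure" and X and m
    and S :: "'s measure" and U V Xbar Ybar \<tau> x y
begin

abbreviation "pairs \<equiv> path_space \<Otimes>\<^sub>M path_space :: ((ennreal \<Rightarrow> 'a option) \<times> (ennreal \<Rightarrow> 'a option)) measure"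

abbreviation "UV n \<omega> \<equiv> (U n \<omega>, V n \<omega>)"

abbreviation "occurs n \<omega> \<equiv> stage_occurs (\<lambda>k. U k \<omega>) (\<lambda>k. V k \<omega>) n"

abbreviation "btime n \<omega> \<equiv> branching_time (\<lambda>k. U k \<omega>) (\<lambda>k. V k \<omega>) n"

abbreviation "Z n \<omega> \<equiv> survivor (U n \<omega>) (V n \<omega>)"

text \<open>Literally the sigma-algebra in \<open>restart_law\<close>, so that this assumption
  applies after unfolding.\<close>

definition past :: "nat \<Rightarrow> 's measure" where
  "past n = vimage_algebra (space S) (\<lambda>\<omega>. \<lambda>j\<in>{..n}. UV j \<omega>) (\<Pi>\<^sub>M j\<in>{..n}. pairs)"

lemma measurable_UV: "UV n \<in> S \<rightarrow>\<^sub>M pairs"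
  using fv.U_measurable fv.V_measurable by measurable

lemma measurable_history: "(\<lambda>\<omega>. \<lambda>j\<in>{..n}. UV j \<omega>) \<in> S \<rightarrow>\<^sub>M (\<Pi>\<^sub>M j\<in>{..n}. pairs)"
  by (intro measurable_restrict measurable_UV)

lemma space_past [simp]: "space (past n) = space S"
  by (simp add: past_def)

lemma subalgebra_past: "subalgebra S (past n)"
  unfolding subalgebra_def past_def
  using sets_image_in_sets[OF refl measurable_history] by simp

lemma measurable_past: "f \<in> past n \<rightarrow>\<^sub>M N \<Longrightarrow> f \<in> S \<rightarrow>\<^sub>M N"
  by (rule measurable_from_subalg[OF subalgebra_past])

sublocale past: finite_measure_subalgebra S "past n" for n
  by unfold_locales (rule subalgebra_past)

lemma measurable_UV_past:
  assumes "j \<le> n" shows "UV j \<in> past n \<rightarrow>\<^sub>M pairs"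
proof -
  have "(\<lambda>\<omega>. \<lambda>j\<in>{..n}. UV j \<omega>) \<in> past n \<rightarrow>\<^sub>M (\<Pi>\<^sub>M j\<in>{..n}. pairs)"
    unfolding past_def using measurable_space[OF measurable_history]
    by (intro measurable_vimage_algebra1) auto
  from measurable_compose[OF this measurable_component_singleton[of j]]
  show ?thesis using assms by simp
qed

lemma measurable_Z_past: "j \<le> n \<Longrightarrow> Z j \<in> past n \<rightarrow>\<^sub>M cem_borel"
  using measurable_compose[OF measurable_UV_past measurable_survivor] by simp

text \<open>Whether stage \<open>Suc n\<close> occurs is decided by the survivor of stage
  \<open>n\<close>, hence the bound \<open>Suc n\<close>. The branching times are shifted in the
  same way.\<close>

lemma occurs_past: "k \<le> Suc n \<Longrightarrow> {\<omega> \<in> space S. occurs k \<omega>} \<in> sets (past n)"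
proof (induction k)
  case 0
  then show ?case using sets.top[of "past n"] by simp
next
  case (Suc k)
  have "{\<omega> \<in> space S. occurs (Suc k) \<omega>} = {\<omega> \<in> space S. occurs k \<omega>} \<inter> (Z k -` range Some \<inter> space (past n))"
    by (auto simp: notin_range_Some)
  also have "\<dots> \<in> sets (past n)"
    using Suc by (intro sets.Int measurable_sets[OF measurable_Z_past range_Some_cem]) auto
  finally show ?case .
qed

lemma btime_past: "k \<le> Suc n \<Longrightarrow> btime k \<in> borel_measurable (past n)"
proof (induction k)
  case (Suc k)
  have 1: "(\<lambda>\<omega>. stage_length (U k \<omega>) (V k \<omega>)) \<in> borel_measurable (past n)"
    using measurable_compose[OF measurable_UV_past measurable_stage_length] Suc by simp
  have "{\<omega> \<in> space (past n). occurs k \<omega>} \<in> sets (past n)"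
    using occurs_past[of k n] Suc by simp
  then show ?case
    using Suc 1 by (simp add: measurable_If)
qed simp

lemma UV_cadlag: "\<omega> \<in> space S \<Longrightarrow> U n \<omega> \<in> cadlag_paths \<and> V n \<omega> \<in> cadlag_paths"
  using measurable_space[OF fv.U_measurable] measurable_space[OF fv.V_measurable] by auto

abbreviation "alive_at n \<equiv> indicator {\<omega> \<in> space S. occurs (Suc n) \<omega>} :: 's \<Rightarrow> ennreal"

lemma alive_at_past: "alive_at n \<in> borel_measurable (past n)"
  by (intro borel_measurable_indicator occurs_past) simp

lemma sets_QQ: "sets (Q z \<Otimes>\<^sub>M Q z') = sets pairs"
  by (intro sets_pair_measure_cong) simp_all

lemma prob_space_QQ: "prob_space (Q z \<Otimes>\<^sub>M Q z')"
proof -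
  interpret z: prob_space "Q z" by (rule prob_space_Q)
  interpret z': prob_space "Q z'" by (rule prob_space_Q)
  interpret pair_prob_space "Q z" "Q z'" ..
  show ?thesis by unfold_locales
qed

text \<open>The conditional law given the past is only known set by set. Carrying a measurable version \<open>h\<close>
  of the conditional integral along the induction avoids measurability in \<open>z\<close> of the path law.\<close>

lemma restart_nn_integral:
  assumes g: "g \<in> borel_measurable pairs"
  obtains h where "h \<in> borel_measurable (past n)"
    and "AE \<omega> in S. occurs (Suc n) \<omega> \<longrightarrow> h \<omega> = (\<integral>\<^sup>+ p. g p \<partial>(Q (Z n \<omega>) \<Otimes>\<^sub>M Q (Z n \<omega>)))"
    and "\<forall>k\<in>borel_measurable (past n).
      (\<integral>\<^sup>+ \<omega>. k \<omega> * alive_at n \<omega> * g (UV (Suc n) \<omega>) \<partial>S) = (\<integral>\<^sup>+ \<omega>. k \<omega> * alive_at n \<omega> * h \<omega> \<partial>S)"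
proof -
  let ?int = "\<lambda>g \<omega>. \<integral>\<^sup>+ p. g p \<partial>(Q (Z n \<omega>) \<Otimes>\<^sub>M Q (Z n \<omega>))"
  let ?P = "\<lambda>g h. h \<in> borel_measurable (past n) \<and>
      (AE \<omega> in S. occurs (Suc n) \<omega> \<longrightarrow> h \<omega> = ?int g \<omega>) \<and>
      (\<forall>k\<in>borel_measurable (past n).
      (\<integral>\<^sup>+ \<omega>. k \<omega> * alive_at n \<omega> * g (UV (Suc n) \<omega>) \<partial>S) = (\<integral>\<^sup>+ \<omega>. k \<omega> * alive_at n \<omega> * h \<omega> \<partial>S))"
  have UVm: "(\<lambda>\<omega>. g (UV (Suc n) \<omega>)) \<in> borel_measurable S" if "g \<in> borel_measurable pairs" for g :: "_ \<Rightarrow> ennreal"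
    by (rule measurable_compose[OF measurable_UV that])
  have km: "(\<lambda>\<omega>. k \<omega> * alive_at n \<omega>) \<in> borel_measurable (past n)" if "k \<in> borel_measurable (past n)" for k
    by (rule borel_measurable_times_ennreal[OF that alive_at_past])
  have gQ: "g \<in> borel_measurable (Q z \<Otimes>\<^sub>M Q z)" if "g \<in> borel_measurable pairs" for g :: "_ \<Rightarrow> ennreal" and z
    using that by (simp add: measurable_cong_sets[OF sets_QQ refl])
  have "\<exists>h. ?P g h"
    using g
  proof (induction rule: borel_measurable_induct)
    case (cong f g)
    then obtain h where h: "?P g h" by blast
    have "f (UV (Suc n) \<omega>) = g (UV (Suc n) \<omega>)" if "\<omega> \<in> space S" for \<omega>
      using cong(3) measurable_space[OF measurable_UV that] by auto
    then have 1: "(\<integral>\<^sup>+ \<omega>. k \<omega> * alive_at n \<omega> * f (UV (Suc n) \<omega>) \<partial>S)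
        = (\<integral>\<^sup>+ \<omega>. k \<omega> * alive_at n \<omega> * g (UV (Suc n) \<omega>) \<partial>S)" for k
      by (intro nn_integral_cong) simp
    have 2: "?int f \<omega> = ?int g \<omega>" for \<omega>
      using cong(3) by (intro nn_integral_cong) (auto simp: sets_eq_imp_space_eq[OF sets_QQ])
    show ?case using h unfolding 1 2 by blast
  next
    \<comment> \<open>The one case where \<open>restart_law\<close> enters. The version is the
      conditional expectation itself, matched with the product law only where the stage
      occurs.\<close>
    case (set A)
    let ?I = "{\<omega> \<in> space S. UV (Suc n) \<omega> \<in> A}"
    have I: "?I \<in> sets S"
      using measurable_sets[OF measurable_UV set, of "Suc n"] by (simp add: vimage_def Int_def conj_commute)
    define h where "h = nn_cond_exp S (past n) (\<lambda>\<omega>. ennreal (indicator ?I \<omega>))"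
    have 1: "AE \<omega> in S. ennreal (real_cond_exp S (past n) (indicator ?I) \<omega>) = h \<omega>"
      unfolding h_def using I by (intro past.AE_real_cond_exp_eq_nn_cond_exp) auto
    have 2: "AE \<omega> in S. occurs (Suc n) \<omega> \<longrightarrow> real_cond_exp S (past n) (indicator ?I) \<omega>
        = measure (Q (Z n \<omega>) \<Otimes>\<^sub>M Q (Z n \<omega>)) A"
      unfolding past_def by (rule fv.restart_law[OF set])
    have emeas: "?int (indicator A) \<omega> = ennreal (measure (Q (Z n \<omega>) \<Otimes>\<^sub>M Q (Z n \<omega>)) A)" for \<omega>
      using set by (simp add: sets_QQ finite_measure.emeasure_eq_measure[OF prob_space.finite_measure[OF prob_space_QQ]])
    have "AE \<omega> in S. occurs (Suc n) \<omega> \<longrightarrow> h \<omega> = ?int (indicator A) \<omega>"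
      using 1 2 by eventually_elim (auto simp: emeas)
    moreover have "h \<in> borel_measurable (past n)"
      unfolding h_def by (rule borel_measurable_nn_cond_exp)
    moreover have "(\<integral>\<^sup>+ \<omega>. k \<omega> * alive_at n \<omega> * indicator A (UV (Suc n) \<omega>) \<partial>S)
        = (\<integral>\<^sup>+ \<omega>. k \<omega> * alive_at n \<omega> * h \<omega> \<partial>S)" if "k \<in> borel_measurable (past n)" for k
    proof -
      have "(\<integral>\<^sup>+ \<omega>. k \<omega> * alive_at n \<omega> * h \<omega> \<partial>S)
          = (\<integral>\<^sup>+ \<omega>. k \<omega> * alive_at n \<omega> * ennreal (indicator ?I \<omega>) \<partial>S)"
        unfolding h_def using I by (intro past.nn_cond_exp_intg km that) auto
      also have "\<dots> = (\<integral>\<^sup>+ \<omega>. k \<omega> * alive_at n \<omega> * indicator A (UV (Suc n) \<omega>) \<partial>S)"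
        by (intro nn_integral_cong) (auto simp: indicator_def)
      finally show ?thesis by simp
    qed
    ultimately show ?case by blast
  next
    case (mult g c)
    then obtain h where h: "?P g h" by blast
    have "?P (\<lambda>p. c * g p) (\<lambda>\<omega>. c * h \<omega>)"
    proof (intro conjI ballI)
      show "(\<lambda>\<omega>. c * h \<omega>) \<in> borel_measurable (past n)" using h by auto
      have "?int (\<lambda>p. c * g p) \<omega> = c * ?int g \<omega>" for \<omega>
        by (intro nn_integral_cmult gQ mult)
      then show "AE \<omega> in S. occurs (Suc n) \<omega> \<longrightarrow> c * h \<omega> = ?int (\<lambda>p. c * g p) \<omega>"
        using h by (auto elim!: eventually_mono)
      fix k :: "'s \<Rightarrow> ennreal" assume k: "k \<in> borel_measurable (past n)"
      \<comment> \<open>The constant is absorbed into the test function, for which the induction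
        hypothesis is available.\<close>
      then have "(\<lambda>\<omega>. k \<omega> * c) \<in> borel_measurable (past n)" by auto
      from bspec[OF conjunct2[OF conjunct2[OF h]] this]
      show "(\<integral>\<^sup>+ \<omega>. k \<omega> * alive_at n \<omega> * (c * g (UV (Suc n) \<omega>)) \<partial>S)
          = (\<integral>\<^sup>+ \<omega>. k \<omega> * alive_at n \<omega> * (c * h \<omega>) \<partial>S)"
        by (simp add: mult_ac)
    qed
    then show ?case by blast
  next
    case (add g f)
    then obtain h1 h2 where h1: "?P f h1" and h2: "?P g h2" by blast
    have "?P (\<lambda>p. f p + g p) (\<lambda>\<omega>. h1 \<omega> + h2 \<omega>)"
    proof (intro conjI ballI)
      show "(\<lambda>\<omega>. h1 \<omega> + h2 \<omega>) \<in> borel_measurable (past n)" using h1 h2 by auto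
      have "?int (\<lambda>p. f p + g p) \<omega> = ?int f \<omega> + ?int g \<omega>" for \<omega>
        by (intro nn_integral_add gQ add)
      moreover have "AE \<omega> in S. occurs (Suc n) \<omega> \<longrightarrow> h1 \<omega> = ?int f \<omega>"
        "AE \<omega> in S. occurs (Suc n) \<omega> \<longrightarrow> h2 \<omega> = ?int g \<omega>" using h1 h2 by auto
      ultimately show "AE \<omega> in S. occurs (Suc n) \<omega> \<longrightarrow> h1 \<omega> + h2 \<omega> = ?int (\<lambda>p. f p + g p) \<omega>"
        by (auto elim!: eventually_elim2)
      fix k :: "'s \<Rightarrow> ennreal" assume k: "k \<in> borel_measurable (past n)"
      have kS: "(\<lambda>\<omega>. k \<omega> * alive_at n \<omega>) \<in> borel_measurable S"
        by (rule measurable_past[OF km[OF k]])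
      have hS: "h1 \<in> borel_measurable S" "h2 \<in> borel_measurable S"
        by (rule measurable_past[OF conjunct1[OF h1]], rule measurable_past[OF conjunct1[OF h2]])
      have "(\<integral>\<^sup>+ \<omega>. k \<omega> * alive_at n \<omega> * (f (UV (Suc n) \<omega>) + g (UV (Suc n) \<omega>)) \<partial>S)
         = (\<integral>\<^sup>+ \<omega>. k \<omega> * alive_at n \<omega> * f (UV (Suc n) \<omega>) \<partial>S) + (\<integral>\<^sup>+ \<omega>. k \<omega> * alive_at n \<omega> * g (UV (Suc n) \<omega>) \<partial>S)"
        unfolding distrib_left by (intro nn_integral_add borel_measurable_times_ennreal kS UVm add)
      also have "\<dots> = (\<integral>\<^sup>+ \<omega>. k \<omega> * alive_at n \<omega> * h1 \<omega> \<partial>S) + (\<integral>\<^sup>+ \<omega>. k \<omega> * alive_at n \<omega> * h2 \<omega> \<partial>S)"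
        using h1 h2 k by simp
      also have "\<dots> = (\<integral>\<^sup>+ \<omega>. k \<omega> * alive_at n \<omega> * (h1 \<omega> + h2 \<omega>) \<partial>S)"
        unfolding distrib_left by (intro nn_integral_add[symmetric] borel_measurable_times_ennreal kS hS)
      finally show "(\<integral>\<^sup>+ \<omega>. k \<omega> * alive_at n \<omega> * (f (UV (Suc n) \<omega>) + g (UV (Suc n) \<omega>)) \<partial>S)
         = (\<integral>\<^sup>+ \<omega>. k \<omega> * alive_at n \<omega> * (h1 \<omega> + h2 \<omega>) \<partial>S)" .
    qed
    then show ?case by blast
  next
    case (seq G)
    have "\<exists>h. \<forall>i. ?P (G i) (h i)"
      by (rule choice) (intro allI seq.IH)
    then obtain h where "\<forall>i. ?P (G i) (h i)" by (rule exE)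
    then have h: "?P (G i) (h i)" for i by (rule spec)
    have inc: "incseq G" using seq by simp
    have sup: "(SUP i. G i) = (\<lambda>p. SUP i. G i p)" by (rule ext) (rule SUP_apply)
    have "AE \<omega> in S. \<forall>i. occurs (Suc n) \<omega> \<longrightarrow> h i \<omega> = ?int (G i) \<omega>"
      unfolding AE_all_countable using h by blast
    moreover have int_sup: "?int (\<lambda>p. SUP i. G i p) \<omega> = (SUP i. ?int (G i) \<omega>)" for \<omega>
      using seq by (intro nn_integral_monotone_convergence_SUP gQ) auto
    have int_mono: "?int (G i) \<omega> \<le> ?int (G (Suc i)) \<omega>" for i \<omega>
      using inc by (intro nn_integral_mono) (auto simp: incseq_Suc_iff le_fun_def)
    \<comment> \<open>The versions \<open>h i\<close> are known to increase only almost surely and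
      only where the stage occurs; the factor \<open>alive_at n\<close> masks the rest.\<close>
    have mono: "AE \<omega> in S. alive_at n \<omega> * h i \<omega> \<le> alive_at n \<omega> * h (Suc i) \<omega>" for i
      using calculation
    proof eventually_elim
      case (elim \<omega>)
      then show ?case using int_mono by (auto simp: indicator_def)
    qed
    have "?P (\<lambda>p. SUP i. G i p) (\<lambda>\<omega>. SUP i. h i \<omega>)"
    proof (intro conjI ballI)
      show "(\<lambda>\<omega>. SUP i. h i \<omega>) \<in> borel_measurable (past n)" using h by (intro borel_measurable_SUP) auto
      show "AE \<omega> in S. occurs (Suc n) \<omega> \<longrightarrow> (SUP i. h i \<omega>) = ?int (\<lambda>p. SUP i. G i p) \<omega>"
        using calculation by eventually_elim (simp add: int_sup)
      fix k :: "'s \<Rightarrow> ennreal" assume k: "k \<in> borel_measurable (past n)"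
      have kS: "(\<lambda>\<omega>. k \<omega> * alive_at n \<omega>) \<in> borel_measurable S"
        by (rule measurable_past[OF km[OF k]])
      have hS: "h i \<in> borel_measurable S" for i
        by (rule measurable_past[OF conjunct1[OF h]])
      have "(\<integral>\<^sup>+ \<omega>. k \<omega> * alive_at n \<omega> * (SUP i. G i (UV (Suc n) \<omega>)) \<partial>S)
         = (\<integral>\<^sup>+ \<omega>. (SUP i. k \<omega> * alive_at n \<omega> * G i (UV (Suc n) \<omega>)) \<partial>S)"
        by (simp add: SUP_mult_left_ennreal)
      also have "\<dots> = (SUP i. \<integral>\<^sup>+ \<omega>. k \<omega> * alive_at n \<omega> * G i (UV (Suc n) \<omega>) \<partial>S)"
        using inc by (intro nn_integral_monotone_convergence_SUP borel_measurable_times_ennreal kS UVm seq)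
          (auto simp: incseq_def le_fun_def intro!: mult_left_mono)
      also have "\<dots> = (SUP i. \<integral>\<^sup>+ \<omega>. k \<omega> * alive_at n \<omega> * h i \<omega> \<partial>S)"
        using h k by simp
      also have "\<dots> = (\<integral>\<^sup>+ \<omega>. (SUP i. k \<omega> * alive_at n \<omega> * h i \<omega>) \<partial>S)"
      proof (rule nn_integral_monotone_convergence_SUP_AE[symmetric, OF _ borel_measurable_times_ennreal[OF kS hS]])
        fix i show "AE \<omega> in S. k \<omega> * alive_at n \<omega> * h i \<omega> \<le> k \<omega> * alive_at n \<omega> * h (Suc i) \<omega>"
          using mono[of i] by eventually_elim (auto simp: mult.assoc intro!: mult_left_mono)
      qed
      also have "\<dots> = (\<integral>\<^sup>+ \<omega>. k \<omega> * alive_at n \<omega> * (SUP i. h i \<omega>) \<partial>S)"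
        by (simp add: SUP_mult_left_ennreal)
      finally show "(\<integral>\<^sup>+ \<omega>. k \<omega> * alive_at n \<omega> * (SUP i. G i (UV (Suc n) \<omega>)) \<partial>S)
         = (\<integral>\<^sup>+ \<omega>. k \<omega> * alive_at n \<omega> * (SUP i. h i \<omega>) \<partial>S)" .
    qed
    then show ?case unfolding sup by blast
  qed
  then show thesis using that by blast
qed

end

section \<open>Discounted expectations along the stages\<close>

context hunt_fleming_viot
begin

definition stage_expectation :: "nat \<Rightarrow> ('a option \<Rightarrow> ennreal) \<Rightarrow> ennreal" where
  "stage_expectation n f = (\<integral>\<^sup>+ \<omega>. discount (btime (Suc n) \<omega>) * alive_at n \<omega> * f (Z n \<omega>) \<partial>S)"

lemma stage_expectation_0:
  assumes f: "f \<in> borel_measurable cem_borel"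
  shows "stage_expectation 0 f = branch_op f (Some x) (Some y)"
proof -
  let ?g = "\<lambda>p. discount (stage_length (fst p) (snd p)) * alive f (survivor (fst p) (snd p))"
  have "stage_expectation 0 f = (\<integral>\<^sup>+ \<omega>. ?g (UV 0 \<omega>) \<partial>S)"
    unfolding stage_expectation_def
    by (intro nn_integral_cong) (auto simp: indicator_def notin_range_Some)
  also have "\<dots> = (\<integral>\<^sup>+ p. ?g p \<partial>distr S pairs (UV 0))"
    using measurable_branch_integrand[OF f]
    by (intro nn_integral_distr[symmetric, OF measurable_UV]) simp
  finally show ?thesis
    unfolding fv.initial_law branch_op_def .
qed

text \<open>Conditioning on the past strips the last stage: \<open>btime (Suc n)\<close> is known
  there, \<open>discount\<close> is multiplicative, and the conditional integral is one application
  of \<open>branch_op\<close> on the diagonal.\<close>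

lemma stage_expectation_Suc:
  assumes f: "f \<in> borel_measurable cem_borel"
  shows "stage_expectation (Suc n) f = stage_expectation n (\<lambda>z. branch_op f z z)"
proof -
  let ?g = "\<lambda>p. discount (stage_length (fst p) (snd p)) * alive f (survivor (fst p) (snd p))"
  obtain h where "h \<in> borel_measurable (past n)"
    and h: "AE \<omega> in S. occurs (Suc n) \<omega> \<longrightarrow> h \<omega> = (\<integral>\<^sup>+ p. ?g p \<partial>(Q (Z n \<omega>) \<Otimes>\<^sub>M Q (Z n \<omega>)))"
    and eq: "\<forall>k\<in>borel_measurable (past n).
      (\<integral>\<^sup>+ \<omega>. k \<omega> * alive_at n \<omega> * ?g (UV (Suc n) \<omega>) \<partial>S) = (\<integral>\<^sup>+ \<omega>. k \<omega> * alive_at n \<omega> * h \<omega> \<partial>S)"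
    by (rule restart_nn_integral[OF measurable_branch_integrand[OF f], of n])
  have k: "(\<lambda>\<omega>. discount (btime (Suc n) \<omega>)) \<in> borel_measurable (past n)"
    by (rule measurable_compose[OF btime_past measurable_discount]) simp
  have "stage_expectation (Suc n) f
      = (\<integral>\<^sup>+ \<omega>. discount (btime (Suc n) \<omega>) * alive_at n \<omega> * ?g (UV (Suc n) \<omega>) \<partial>S)"
    unfolding stage_expectation_def
  proof (rule nn_integral_cong)
    fix \<omega> assume \<omega>: "\<omega> \<in> space S"
    show "discount (btime (Suc (Suc n)) \<omega>) * alive_at (Suc n) \<omega> * f (Z (Suc n) \<omega>)
        = discount (btime (Suc n) \<omega>) * alive_at n \<omega> * ?g (UV (Suc n) \<omega>)"
    proof (cases "occurs (Suc n) \<omega>")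
      case True
      have "btime (Suc (Suc n)) \<omega> = btime (Suc n) \<omega> + stage_length (U (Suc n) \<omega>) (V (Suc n) \<omega>)"
        using True by (subst branching_time.simps) (simp only: if_True)
      moreover have "alive_at (Suc n) \<omega> = indicator (range Some) (Z (Suc n) \<omega>)"
        using True \<omega> by (auto simp: indicator_def notin_range_Some)
      moreover have "alive_at n \<omega> = 1" using True \<omega> by (simp add: indicator_def)
      ultimately show ?thesis by (simp only: discount_add fst_conv snd_conv mult_1_right mult.assoc)
    qed (auto simp: indicator_def)
  qed
  also have "\<dots> = (\<integral>\<^sup>+ \<omega>. discount (btime (Suc n) \<omega>) * alive_at n \<omega> * h \<omega> \<partial>S)"
    by (rule eq[rule_format, OF k])
  also have "\<dots> = stage_expectation n (\<lambda>z. branch_op f z z)"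
    unfolding stage_expectation_def branch_op_def
  proof (rule nn_integral_cong_AE)
    show "AE \<omega> in S. discount (btime (Suc n) \<omega>) * alive_at n \<omega> * h \<omega>
        = discount (btime (Suc n) \<omega>) * alive_at n \<omega> * (\<integral>\<^sup>+ p. ?g p \<partial>(Q (Z n \<omega>) \<Otimes>\<^sub>M Q (Z n \<omega>)))"
      using h by eventually_elim (auto simp: indicator_def)
  qed
  finally show ?thesis .
qed

text \<open>The offset \<open>k\<close> is general because stripping a stage lowers \<open>n\<close>
  and raises \<open>k\<close> by one. The first stage, with its own two starts, is left off the
  diagonal.\<close>

lemma stage_expectation_iterated_discount:
  "stage_expectation n (iterated_discount k) = branch_op (iterated_discount (n + k)) (Some x) (Some y)"
proof (induction n arbitrary: k)
  case 0
  show ?case by (simp add: stage_expectation_0[OF measurable_iterated_discount])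
next
  case (Suc n)
  then show ?case
    by (simp add: stage_expectation_Suc[OF measurable_iterated_discount] flip: iterated_discount_Suc)
qed

lemma discounted_survival_tendsto:
  "(\<lambda>n. \<integral>\<^sup>+ \<omega>. discount (btime (Suc n) \<omega>) * alive_at n \<omega> \<partial>S) \<longlonglongrightarrow> 0"
proof -
  have "(\<integral>\<^sup>+ \<omega>. discount (btime (Suc n) \<omega>) * alive_at n \<omega> \<partial>S) = branch_op (iterated_discount n) (Some x) (Some y)" for n
    using stage_expectation_iterated_discount[of n 0] by (simp only: stage_expectation_def iterated_discount_0 mult_1_right add_0_right)
  then show ?thesis
    using branch_op_iterated_discount_tendsto[of "Some x" "Some y"] by (simp add: branch_op_limit_discount)
qed

text \<open>If all stages occur, every discounted term is at least the discount of the limit time.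
  The expectations tend to 0, so that discount is almost surely 0 and the time infinite.\<close>

lemma AE_not_survive_in_finite_time:
  "AE \<omega> in S. (\<forall>n. occurs n \<omega>) \<longrightarrow> (SUP n. btime n \<omega>) = \<infinity>"
proof -
  let ?E = "\<lambda>n \<omega>. discount (btime (Suc n) \<omega>) * alive_at n \<omega>"
  have E: "?E n \<in> borel_measurable S" for n
    by (rule measurable_past[of _ n], rule borel_measurable_times_ennreal[OF _ alive_at_past],
        rule measurable_compose[OF btime_past measurable_discount]) simp
  have "(\<integral>\<^sup>+ \<omega>. (INF n. ?E n \<omega>) \<partial>S) \<le> (\<integral>\<^sup>+ \<omega>. ?E n \<omega> \<partial>S)" for n
    by (intro nn_integral_mono INF_lower) simp
  then have "(\<integral>\<^sup>+ \<omega>. (INF n. ?E n \<omega>) \<partial>S) \<le> 0"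
    by (intro LIMSEQ_le_const[OF discounted_survival_tendsto]) auto
  then have "AE \<omega> in S. (INF n. ?E n \<omega>) = 0"
    using E by (subst (asm) le_zero_eq, subst (asm) nn_integral_0_iff_AE) auto
  then show ?thesis
    using AE_space
  proof eventually_elim
    case (elim \<omega>)
    show ?case
    proof
      assume occ: "\<forall>n. occurs n \<omega>"
      have "discount (SUP n. btime n \<omega>) \<le> (INF n. ?E n \<omega>)"
      proof (rule INF_greatest)
        fix n
        have "alive_at n \<omega> = 1" using occ[rule_format, of "Suc n"] elim(2) by (simp add: indicator_def)
        then show "discount (SUP n. btime n \<omega>) \<le> ?E n \<omega>"
          by (simp only: mult_1_right) (intro discount_antimono SUP_upper UNIV_I)
      qed
      then show "(SUP n. btime n \<omega>) = \<infinity>"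
        using elim(1) by (simp add: discount_eq_0_iff)
    qed
  qed
qed

text \<open>A later stage starts both particles at the previous survivor, so
  \<open>AE_no_tie\<close> with equal starts applies, transferred by
  \<open>restart_nn_integral\<close> for the indicator of a finite tie.\<close>

lemma AE_tie_only_at_infinity:
  "AE \<omega> in S. \<forall>n. occurs n \<omega> \<longrightarrow> lifetime (U n \<omega>) = lifetime (V n \<omega>) \<longrightarrow> lifetime (U n \<omega>) = \<infinity>"
  unfolding AE_all_countable
proof
  fix n
  let ?T = "{p \<in> space pairs. lifetime (fst p) = lifetime (snd p) \<longrightarrow> lifetime (fst p) = \<infinity>}"
  have [measurable]: "(\<lambda>p. lifetime (fst p)) \<in> borel_measurable pairs"
      "(\<lambda>p. lifetime (snd p)) \<in> borel_measurable pairs"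
    by (rule measurable_compose[OF _ measurable_lifetime], simp)+
  have T: "?T \<in> sets pairs" by measurable
  have tie: "AE p in Q (Some a) \<Otimes>\<^sub>M Q (Some b). p \<in> ?T" for a b
    using AE_no_tie[of a b] AE_space
    by eventually_elim (auto simp: space_pair_measure)
  show "AE \<omega> in S. occurs n \<omega> \<longrightarrow> lifetime (U n \<omega>) = lifetime (V n \<omega>) \<longrightarrow> lifetime (U n \<omega>) = \<infinity>"
  proof (cases n)
    case 0
    have "AE p in distr S pairs (UV 0). p \<in> ?T"
      unfolding fv.initial_law by (rule tie)
    then have "AE \<omega> in S. UV 0 \<omega> \<in> ?T"
      by (subst (asm) AE_distr_iff[OF measurable_UV]) (use T in auto)
    then show ?thesis unfolding 0 by eventually_elim auto
  next
    case (Suc k)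
    let ?g = "indicator (space pairs - ?T) :: _ \<Rightarrow> ennreal"
    have g: "?g \<in> borel_measurable pairs" using T by measurable
    obtain h where "h \<in> borel_measurable (past k)"
      and h: "AE \<omega> in S. occurs (Suc k) \<omega> \<longrightarrow> h \<omega> = (\<integral>\<^sup>+ p. ?g p \<partial>(Q (Z k \<omega>) \<Otimes>\<^sub>M Q (Z k \<omega>)))"
      and eq: "\<forall>f\<in>borel_measurable (past k).
        (\<integral>\<^sup>+ \<omega>. f \<omega> * alive_at k \<omega> * ?g (UV (Suc k) \<omega>) \<partial>S) = (\<integral>\<^sup>+ \<omega>. f \<omega> * alive_at k \<omega> * h \<omega> \<partial>S)"
      by (rule restart_nn_integral[OF g, of k])
    have zero: "(\<integral>\<^sup>+ p. ?g p \<partial>(Q (Some a) \<Otimes>\<^sub>M Q (Some a))) = 0" for a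
    proof -
      have "(\<integral>\<^sup>+ p. ?g p \<partial>(Q (Some a) \<Otimes>\<^sub>M Q (Some a))) = (\<integral>\<^sup>+ p. 0 \<partial>(Q (Some a) \<Otimes>\<^sub>M Q (Some a)))"
      proof (rule nn_integral_cong_AE)
        show "AE p in Q (Some a) \<Otimes>\<^sub>M Q (Some a). ?g p = 0"
          using tie[of a a] by eventually_elim (simp only: indicator_def Diff_iff, simp)
      qed
      then show ?thesis by simp
    qed
    have "(\<integral>\<^sup>+ \<omega>. alive_at k \<omega> * ?g (UV (Suc k) \<omega>) \<partial>S) = (\<integral>\<^sup>+ \<omega>. alive_at k \<omega> * h \<omega> \<partial>S)"
      using bspec[OF eq, of "\<lambda>_. 1"] by simp
    also have "\<dots> = (\<integral>\<^sup>+ \<omega>. 0 \<partial>S)"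
    proof (rule nn_integral_cong_AE)
      show "AE \<omega> in S. alive_at k \<omega> * h \<omega> = 0"
        using h
      proof eventually_elim
        case (elim \<omega>)
        show ?case
        proof (cases "occurs (Suc k) \<omega>")
          case True
          then obtain a where "Z k \<omega> = Some a" by auto
          then show ?thesis using elim True zero[of a] by simp
        qed (simp add: indicator_def)
      qed
    qed
    finally have "(\<integral>\<^sup>+ \<omega>. alive_at k \<omega> * ?g (UV (Suc k) \<omega>) \<partial>S) = 0" by simp
    moreover have "(\<lambda>\<omega>. alive_at k \<omega> * ?g (UV (Suc k) \<omega>)) \<in> borel_measurable S"
      by (intro borel_measurable_times_ennreal measurable_past[OF alive_at_past]
          measurable_compose[OF measurable_UV g])
    ultimately have "AE \<omega> in S. alive_at k \<omega> * ?g (UV (Suc k) \<omega>) = 0"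
      by (simp only: nn_integral_0_iff_AE)
    then show ?thesis
      unfolding Suc using AE_space
    proof eventually_elim
      case (elim \<omega>)
      show ?case
      proof (rule impI)
        assume "occurs (Suc k) \<omega>"
        then have "?g (UV (Suc k) \<omega>) = 0" using elim by (simp add: indicator_def)
        then show "lifetime (U (Suc k) \<omega>) = lifetime (V (Suc k) \<omega>) \<longrightarrow> lifetime (U (Suc k) \<omega>) = \<infinity>"
          using measurable_space[OF measurable_UV elim(2), of "Suc k"] by (auto simp: indicator_def)
      qed
    qed
  qed
qed

text \<open>If some stage does not occur, the last stage that does had no survivor; its lifetimes
  agree, so almost surely they are infinite, and this one stage already makes the total time
  infinite. If all stages occur, the discounted estimate decides.\<close>

lemma non_extinction: "AE \<omega> in S. (SUP n. \<tau> n \<omega>) = \<infinity>"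
  using AE_not_survive_in_finite_time AE_tie_only_at_infinity AE_space
proof eventually_elim
  case (elim \<omega>)
  have \<tau>: "\<tau> n \<omega> = btime n \<omega>" for n by (rule fv.tau_eq[OF elim(3)])
  show ?case
  proof (cases "\<forall>n. occurs n \<omega>")
    case False
    define n where "n = (LEAST n. \<not> occurs n \<omega>)"
    from False obtain j where "\<not> occurs j \<omega>" by blast
    then have n: "\<not> occurs n \<omega>" unfolding n_def by (rule LeastI)
    have least: "occurs k \<omega>" if "k < n" for k
      using not_less_Least[of k "\<lambda>n. \<not> occurs n \<omega>"] that unfolding n_def by blast
    have "n \<noteq> 0" using n by (metis stage_occurs.simps(1))
    then obtain k where k: "n = Suc k" by (cases n) auto
    have occ: "occurs k \<omega>" using least k by simp
    then have "Z k \<omega> = None" using n k by simp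
    then have "lifetime (U k \<omega>) = lifetime (V k \<omega>)"
      using survivor_eq_None_iff UV_cadlag[OF elim(3)] by blast
    with elim(2) occ have "stage_length (U k \<omega>) (V k \<omega>) = \<infinity>"
      unfolding stage_length_def by (metis min.idem)
    then have "btime n \<omega> = \<infinity>" using occ k by simp
    moreover have "btime n \<omega> \<le> (SUP n. btime n \<omega>)" by (rule SUP_upper) simp
    ultimately show ?thesis by (simp add: \<tau> top_unique)
  qed (use elim(1) in \<open>simp add: \<tau>\<close>)
qed

end

theorem corollary1p4:
  fixes M :: "'w measure"
    and F :: "ennreal \<Rightarrow> 'w measure"
    and P :: "'a::{metric_space, second_countable_topology} option \<Rightarrow> 'w measure"
    and X :: "ennreal \<Rightarrow> 'w \<Rightarrow> 'a option"
    and m :: "'a measure"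
    and S :: "'s measure"
    and U V :: "nat \<Rightarrow> 's \<Rightarrow> ennreal \<Rightarrow> 'a option"
    and Xbar Ybar :: "ennreal \<Rightarrow> 's \<Rightarrow> 'a option"
    and \<tau> :: "nat \<Rightarrow> 's \<Rightarrow> ennreal"
    and x y :: 'a
  assumes "hunt_process M F P X"
    and "self_dual P X m"
    and "finite_measure m"
    and "\<And>t z. 0 < t \<Longrightarrow> t < \<infinity> \<Longrightarrow> absolutely_continuous m (one_dim_law P X t z)"
    and "fleming_viot_system S (path_law P X) U V Xbar Ybar \<tau> x y"
  shows "measure S {\<omega> \<in> space S. (SUP n. \<tau> n \<omega>) = \<infinity>} = 1"
proof -
  interpret hunt_fleming_viot M F P X m S U V Xbar Ybar \<tau> x y
    using assms
    by (intro hunt_fleming_viot.intro absolutely_continuous_hunt_process.intro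
        self_dual_hunt_process.intro self_dual_hunt_process_axioms.intro
        absolutely_continuous_hunt_process_axioms.intro)
  \<comment> \<open>\<open>measure\<close> is 0 on non-measurable sets, so the event must be shown
    measurable before the almost sure statement yields probability 1.\<close>
  have "btime n \<in> borel_measurable S" for n
    by (rule measurable_past[OF btime_past[of n n]]) simp
  then have "(\<lambda>\<omega>. \<tau> n \<omega>) \<in> borel_measurable S" for n
    using fv.tau_eq by (simp cong: measurable_cong)
  then have [measurable]: "(\<lambda>\<omega>. SUP n. \<tau> n \<omega>) \<in> borel_measurable S"
    by (intro borel_measurable_SUP) auto
  have "{\<omega> \<in> space S. (SUP n. \<tau> n \<omega>) = \<infinity>} \<in> sets S"
    by measurable
  from fv.prob_eq_1[OF this] show ?thesis
    using non_extinction by (simp add: AE_space eventually_conj_iff)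
qed

end
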